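(* Let $\mathsf C$ be a Markov category with conditionals. For every object $V$ of $\mathsf C$, the presheaf of random elements $\mathrm{RE}(V)$ on $\mathcal S(\mathsf C)$ is an atomic sheaf; and for every sample space $\mathbf V$ in $\mathcal S(\mathsf C)$, the representable presheaf $\mathbf y(\mathbf V)=\mathcal S(\mathsf C)(-,\mathbf V)$ is an atomic sheaf.
   Context: A Markov category is a symmetric monoidal category $(\mathsf C,\otimes,I)$ (coherence isomorphisms suppressed) whose unit $I$ is terminal and in which every object $X$ carries a commutative comonoid structure $\mathrm{copy}_X:X\to X\otimes X$, $\mathrm{del}_X:X\to I$ compatible with the monoidal structure ($\mathrm{copy}_{X\otimes Y}$ is $\mathrm{copy}_X\otimes\mathrm{copy}_Y$ followed by the swap of the two middle factors, $\mathrm{del}_{X\otimes Y}=\mathrm{del}_X\otimes\mathrm{del}_Y$, and the structure on $I$ is trivial). The projections $\pi_X:X\otimes Y\to X$, $\pi_Y:X\otimes Y\to Y$ are obtained by deleting the other factor. For $f:A\to X$, $g:A\to Y$ write $\langle f,g\rangle=(f\otimes g)\circ\mathrm{copy}_A$. A state is a morphism $p:I\to X$. $\mathsf C$ has conditionals if for every $f:A\to X\otimes Y$ there is $f|_X:X\otimes A\to Y$ with $f=(\mathrm{id}_X\otimes f|_X)\circ(\mathrm{copy}_X\otimes \mathrm{id}_A)\circ((\pi_X f)\otimes\mathrm{id}_A)\circ\mathrm{copy}_A$. For $f,g:X\to Y$ and a state $p:I\to X$, $f=_p g$ ($p$-almost sure equality) means $\langle \mathrm{id}_X,f\rangle\circ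 p=\langle\mathrm{id}_X,g\rangle\circ p$; $f$ is $p$-almost surely deterministic if $\mathrm{copy}_Y\circ f=_p(f\otimes f)\circ\mathrm{copy}_X$. The category $\mathcal S(\mathsf C)$ of sample spaces has objects $(\Omega,p)$ with $p:I\to\Omega$ a state; morphisms $(\Omega,p)\to(\Omega',q)$ are $p$-almost sure equality classes of $p$-almost surely deterministic $f:\Omega\to\Omega'$ with $f\circ p=q$; composition is that of $\mathsf C$ on representatives. For a presheaf $P:\mathcal S(\mathsf C)^{\mathrm{op}}\to\mathbf{Set}$, $\pi:\Omega'\to\Omega$ and $x\in P(\Omega)$ write $x\cdot\pi=P(\pi)(x)$. For an object $V$ of $\mathsf C$, $\mathrm{RE}(V)(\Omega,p)$ is the set of $p$-almost sure equality classes $[X]$ of $p$-almost surely deterministic morphisms $X:\Omega\to V$ in $\mathsf C$, with $[X]\cdot\pi=[X\circ\pi]$. For $\pi:\Omega'\to\Omega$ in $\mathcal S(\mathsf C)$, $y\in P(\Omega')$ is $\pi$-invariant if for every parallel pair $\rho,\rho':\Omega''\to\Omega'$ in $\mathcal S(\mathsf C)$ with $\pi\circ\rho=\pi\circ\rho'$ we have $y\cdot\rho=y\cdot\rho'$. $P$ is an atomic sheaf if for every $\pi:\Omega'\to\Omega$ and every $\pi$-invariant $y\in P(\Omega')$ there is a unique $x\in P(\Omega)$ with $y=x\cdot\pi$. *)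

theory Defs
  imports Main
begin

section \<open>Categories and presheaves\<close>

record ('o, 'a) cat =
  Obj :: "'o set"
  Arr :: "'a set"
  Dom :: "'a \<Rightarrow> 'o"
  Cod :: "'a \<Rightarrow> 'o"
  Ident :: "'o \<Rightarrow> 'a"
  Comp :: "'a \<Rightarrow> 'a \<Rightarrow> 'a" (infixr "\<cdot>\<index>" 55)

definition hom :: "('o, 'a, 'z) cat_scheme \<Rightarrow> 'o \<Rightarrow> 'o \<Rightarrow> 'a set" where
  "hom C X Y = {f \<in> Arr C. Dom C f = X \<and> Cod C f = Y}"

locale category =
  fixes C :: "('o, 'a, 'z) cat_scheme" (structure)
  assumes Dom_Obj: "f \<in> Arr C \<Longrightarrow> Dom C f \<in> Obj C"
    and Cod_Obj: "f \<in> Arr C \<Longrightarrow> Cod C f \<in> Obj C"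
    and Ident_hom: "X \<in> Obj C \<Longrightarrow> Ident C X \<in> hom C X X"
    and Comp_hom: "\<lbrakk>f \<in> hom C X Y; g \<in> hom C Y Z\<rbrakk> \<Longrightarrow> g \<cdot> f \<in> hom C X Z"
    and Comp_Ident_left: "f \<in> hom C X Y \<Longrightarrow> Ident C Y \<cdot> f = f"
    and Comp_Ident_right: "f \<in> hom C X Y \<Longrightarrow> f \<cdot> Ident C X = f"
    and Comp_assoc:
      "\<lbrakk>f \<in> hom C W X; g \<in> hom C X Y; h \<in> hom C Y Z\<rbrakk> \<Longrightarrow> (h \<cdot> g) \<cdot> f = h \<cdot> (g \<cdot> f)"

definition inverse_arrows :: "('o, 'a, 'z) cat_scheme \<Rightarrow> 'a \<Rightarrow> 'a \<Rightarrow> bool" where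
  "inverse_arrows C f g \<longleftrightarrow>
     f \<in> Arr C \<and> g \<in> hom C (Cod C f) (Dom C f) \<and>
     g \<cdot>\<^bsub>C\<^esub> f = Ident C (Dom C f) \<and> f \<cdot>\<^bsub>C\<^esub> g = Ident C (Cod C f)"

definition is_iso :: "('o, 'a, 'z) cat_scheme \<Rightarrow> 'a \<Rightarrow> bool" where
  "is_iso C f \<longleftrightarrow> (\<exists>g. inverse_arrows C f g)"

definition inv_arr :: "('o, 'a, 'z) cat_scheme \<Rightarrow> 'a \<Rightarrow> 'a" where
  "inv_arr C f = (THE g. inverse_arrows C f g)"

text \<open>\<open>Act P x \<pi>\<close> is the restriction \<open>x \<cdot> \<pi> = P(\<pi>)(x)\<close> of \<open>x \<in> P(Cod \<pi>)\<close> along \<open>\<pi>\<close>.\<close>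

record ('o, 'a, 'x) presheaf_data =
  Sect :: "'o \<Rightarrow> 'x set"
  Act :: "'x \<Rightarrow> 'a \<Rightarrow> 'x"

locale presheaf = category S
  for S :: "('o, 'a, 'z) cat_scheme" (structure) +
  fixes P :: "('o, 'a, 'x) presheaf_data"
  assumes Act_Sect: "\<lbrakk>\<pi> \<in> hom S A B; x \<in> Sect P B\<rbrakk> \<Longrightarrow> Act P x \<pi> \<in> Sect P A"
    and Act_Ident: "\<lbrakk>A \<in> Obj S; x \<in> Sect P A\<rbrakk> \<Longrightarrow> Act P x (Ident S A) = x"
    and Act_Comp:
      "\<lbrakk>\<rho> \<in> hom S A B; \<pi> \<in> hom S B D; x \<in> Sect P D\<rbrakk> \<Longrightarrow> Act P x (\<pi> \<cdot> \<rho>) = Act P (Act P x \<pi>) \<rho>"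

definition invariant ::
  "('o, 'a, 'z) cat_scheme \<Rightarrow> ('o, 'a, 'x) presheaf_data \<Rightarrow> 'a \<Rightarrow> 'x \<Rightarrow> bool" where
  "invariant S P \<pi> y \<longleftrightarrow>
     (\<forall>A\<in>Obj S. \<forall>\<rho>\<in>hom S A (Dom S \<pi>). \<forall>\<rho>'\<in>hom S A (Dom S \<pi>).
        \<pi> \<cdot>\<^bsub>S\<^esub> \<rho> = \<pi> \<cdot>\<^bsub>S\<^esub> \<rho>' \<longrightarrow> Act P y \<rho> = Act P y \<rho>')"

definition atomic_sheaf ::
  "('o, 'a, 'z) cat_scheme \<Rightarrow> ('o, 'a, 'x) presheaf_data \<Rightarrow> bool" where
  "atomic_sheaf S P \<longleftrightarrow> presheaf S P \<and>
     (\<forall>\<pi>\<in>Arr S. \<forall>y\<in>Sect P (Dom S \<pi>). invariant S P \<pi> y \<longrightarrow>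
        (\<exists>!x. x \<in> Sect P (Cod S \<pi>) \<and> y = Act P x \<pi>))"

definition representable ::
  "('o, 'a, 'z) cat_scheme \<Rightarrow> 'o \<Rightarrow> ('o, 'a, 'a) presheaf_data" where
  "representable S V = \<lparr>Sect = (\<lambda>A. hom S A V), Act = (\<lambda>f \<pi>. f \<cdot>\<^bsub>S\<^esub> \<pi>)\<rparr>"


section \<open>Markov categories\<close>

text \<open>
  The monoidal structure is not assumed strict: the coherence isomorphisms
  \<open>assoc X Y Z : (X \<otimes> Y) \<otimes> Z \<rightarrow> X \<otimes> (Y \<otimes> Z)\<close>, \<open>lunit X : I \<otimes> X \<rightarrow> X\<close>, \<open>runit X : X \<otimes> I \<rightarrow> X\<close> and
  \<open>swap X Y : X \<otimes> Y \<rightarrow> Y \<otimes> X\<close> are explicit. The tensor of objects is written \<open>\<odot>\<close>, that of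
  morphisms \<open>\<otimes>\<close>.
\<close>

record ('o, 'a) markov_data = "('o, 'a) cat" +
  tensor_obj :: "'o \<Rightarrow> 'o \<Rightarrow> 'o" (infixr "\<odot>\<index>" 60)
  tensor :: "'a \<Rightarrow> 'a \<Rightarrow> 'a" (infixr "\<otimes>\<index>" 60)
  unit_obj :: "'o" ("\<I>\<index>")
  assoc :: "'o \<Rightarrow> 'o \<Rightarrow> 'o \<Rightarrow> 'a"
  lunit :: "'o \<Rightarrow> 'a"
  runit :: "'o \<Rightarrow> 'a"
  swap :: "'o \<Rightarrow> 'o \<Rightarrow> 'a"
  copy :: "'o \<Rightarrow> 'a"
  del :: "'o \<Rightarrow> 'a"

locale symmetric_monoidal_category = category C
  for C :: "('o, 'a, 'z) markov_data_scheme" (structure) +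
  assumes tensor_obj_Obj: "\<lbrakk>X \<in> Obj C; Y \<in> Obj C\<rbrakk> \<Longrightarrow> X \<odot> Y \<in> Obj C"
    and unit_Obj: "\<I> \<in> Obj C"
    and tensor_hom:
      "\<lbrakk>f \<in> hom C X Y; g \<in> hom C X' Y'\<rbrakk> \<Longrightarrow> f \<otimes> g \<in> hom C (X \<odot> X') (Y \<odot> Y')"
    and tensor_Ident:
      "\<lbrakk>X \<in> Obj C; Y \<in> Obj C\<rbrakk> \<Longrightarrow> Ident C X \<otimes> Ident C Y = Ident C (X \<odot> Y)"
    and tensor_Comp:
      "\<lbrakk>f \<in> hom C X Y; g \<in> hom C Y Z; f' \<in> hom C X' Y'; g' \<in> hom C Y' Z'\<rbrakk> \<Longrightarrow>
         (g \<cdot> f) \<otimes> (g' \<cdot> f') = (g \<otimes> g') \<cdot> (f \<otimes> f')"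
    and assoc_hom:
      "\<lbrakk>X \<in> Obj C; Y \<in> Obj C; Z \<in> Obj C\<rbrakk> \<Longrightarrow>
         assoc C X Y Z \<in> hom C ((X \<odot> Y) \<odot> Z) (X \<odot> (Y \<odot> Z))"
    and assoc_iso: "\<lbrakk>X \<in> Obj C; Y \<in> Obj C; Z \<in> Obj C\<rbrakk> \<Longrightarrow> is_iso C (assoc C X Y Z)"
    and assoc_natural:
      "\<lbrakk>f \<in> hom C X X'; g \<in> hom C Y Y'; h \<in> hom C Z Z'\<rbrakk> \<Longrightarrow>
         assoc C X' Y' Z' \<cdot> ((f \<otimes> g) \<otimes> h) = (f \<otimes> (g \<otimes> h)) \<cdot> assoc C X Y Z"
    and lunit_hom: "X \<in> Obj C \<Longrightarrow> lunit C X \<in> hom C (\<I> \<odot> X) X"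
    and lunit_iso: "X \<in> Obj C \<Longrightarrow> is_iso C (lunit C X)"
    and lunit_natural:
      "f \<in> hom C X Y \<Longrightarrow> lunit C Y \<cdot> (Ident C \<I> \<otimes> f) = f \<cdot> lunit C X"
    and runit_hom: "X \<in> Obj C \<Longrightarrow> runit C X \<in> hom C (X \<odot> \<I>) X"
    and runit_iso: "X \<in> Obj C \<Longrightarrow> is_iso C (runit C X)"
    and runit_natural:
      "f \<in> hom C X Y \<Longrightarrow> runit C Y \<cdot> (f \<otimes> Ident C \<I>) = f \<cdot> runit C X"
    and triangle:
      "\<lbrakk>X \<in> Obj C; Y \<in> Obj C\<rbrakk> \<Longrightarrow>
         (Ident C X \<otimes> lunit C Y) \<cdot> assoc C X \<I> Y = runit C X \<otimes> Ident C Y"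
    and pentagon:
      "\<lbrakk>W \<in> Obj C; X \<in> Obj C; Y \<in> Obj C; Z \<in> Obj C\<rbrakk> \<Longrightarrow>
         assoc C W X (Y \<odot> Z) \<cdot> assoc C (W \<odot> X) Y Z =
         (Ident C W \<otimes> assoc C X Y Z) \<cdot> assoc C W (X \<odot> Y) Z \<cdot> (assoc C W X Y \<otimes> Ident C Z)"
    and swap_hom: "\<lbrakk>X \<in> Obj C; Y \<in> Obj C\<rbrakk> \<Longrightarrow> swap C X Y \<in> hom C (X \<odot> Y) (Y \<odot> X)"
    and swap_natural:
      "\<lbrakk>f \<in> hom C X X'; g \<in> hom C Y Y'\<rbrakk> \<Longrightarrow>
         swap C X' Y' \<cdot> (f \<otimes> g) = (g \<otimes> f) \<cdot> swap C X Y"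
    and swap_swap:
      "\<lbrakk>X \<in> Obj C; Y \<in> Obj C\<rbrakk> \<Longrightarrow> swap C Y X \<cdot> swap C X Y = Ident C (X \<odot> Y)"
    and hexagon:
      "\<lbrakk>X \<in> Obj C; Y \<in> Obj C; Z \<in> Obj C\<rbrakk> \<Longrightarrow>
         assoc C Y Z X \<cdot> swap C X (Y \<odot> Z) \<cdot> assoc C X Y Z =
         (Ident C Y \<otimes> swap C X Z) \<cdot> assoc C Y X Z \<cdot> (swap C X Y \<otimes> Ident C Z)"

text \<open>The coherence isomorphism \<open>(X \<otimes> X) \<otimes> (Y \<otimes> Y) \<rightarrow> (X \<otimes> Y) \<otimes> (X \<otimes> Y)\<close> swapping the two middle factors.\<close>

definition mid_swap :: "('o, 'a, 'z) markov_data_scheme \<Rightarrow> 'o \<Rightarrow> 'o \<Rightarrow> 'a" where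
  "mid_swap C X Y =
     inv_arr C (assoc C X Y (X \<odot>\<^bsub>C\<^esub> Y))
     \<cdot>\<^bsub>C\<^esub> (Ident C X \<otimes>\<^bsub>C\<^esub>
            (assoc C Y X Y \<cdot>\<^bsub>C\<^esub> (swap C X Y \<otimes>\<^bsub>C\<^esub> Ident C Y) \<cdot>\<^bsub>C\<^esub> inv_arr C (assoc C X Y Y)))
     \<cdot>\<^bsub>C\<^esub> assoc C X X (Y \<odot>\<^bsub>C\<^esub> Y)"

locale markov_category = symmetric_monoidal_category C
  for C :: "('o, 'a, 'z) markov_data_scheme" (structure) +
  assumes copy_hom: "X \<in> Obj C \<Longrightarrow> copy C X \<in> hom C X (X \<odot> X)"
    and del_hom: "X \<in> Obj C \<Longrightarrow> del C X \<in> hom C X \<I>"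
    and unit_terminal: "\<lbrakk>X \<in> Obj C; f \<in> hom C X \<I>; g \<in> hom C X \<I>\<rbrakk> \<Longrightarrow> f = g"
    and copy_coassoc:
      "X \<in> Obj C \<Longrightarrow>
         assoc C X X X \<cdot> (copy C X \<otimes> Ident C X) \<cdot> copy C X = (Ident C X \<otimes> copy C X) \<cdot> copy C X"
    and copy_counit_left:
      "X \<in> Obj C \<Longrightarrow> lunit C X \<cdot> (del C X \<otimes> Ident C X) \<cdot> copy C X = Ident C X"
    and copy_counit_right:
      "X \<in> Obj C \<Longrightarrow> runit C X \<cdot> (Ident C X \<otimes> del C X) \<cdot> copy C X = Ident C X"
    and copy_commute: "X \<in> Obj C \<Longrightarrow> swap C X X \<cdot> copy C X = copy C X"
    and copy_tensor:
      "\<lbrakk>X \<in> Obj C; Y \<in> Obj C\<rbrakk> \<Longrightarrow>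
         copy C (X \<odot> Y) = mid_swap C X Y \<cdot> (copy C X \<otimes> copy C Y)"
    and del_tensor:
      "\<lbrakk>X \<in> Obj C; Y \<in> Obj C\<rbrakk> \<Longrightarrow> del C (X \<odot> Y) = lunit C \<I> \<cdot> (del C X \<otimes> del C Y)"
    and copy_unit: "copy C \<I> = inv_arr C (lunit C \<I>)"
    and del_unit: "del C \<I> = Ident C \<I>"

definition proj1 :: "('o, 'a, 'z) markov_data_scheme \<Rightarrow> 'o \<Rightarrow> 'o \<Rightarrow> 'a" where
  "proj1 C X Y = runit C X \<cdot>\<^bsub>C\<^esub> (Ident C X \<otimes>\<^bsub>C\<^esub> del C Y)"

definition pairing :: "('o, 'a, 'z) markov_data_scheme \<Rightarrow> 'a \<Rightarrow> 'a \<Rightarrow> 'a" where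
  "pairing C f g = (f \<otimes>\<^bsub>C\<^esub> g) \<cdot>\<^bsub>C\<^esub> copy C (Dom C f)"

definition has_conditionals :: "('o, 'a, 'z) markov_data_scheme \<Rightarrow> bool" where
  "has_conditionals C \<longleftrightarrow>
     (\<forall>A\<in>Obj C. \<forall>X\<in>Obj C. \<forall>Y\<in>Obj C. \<forall>f\<in>hom C A (X \<odot>\<^bsub>C\<^esub> Y). \<exists>k\<in>hom C (X \<odot>\<^bsub>C\<^esub> A) Y.
        f = (Ident C X \<otimes>\<^bsub>C\<^esub> k) \<cdot>\<^bsub>C\<^esub> assoc C X X A \<cdot>\<^bsub>C\<^esub> (copy C X \<otimes>\<^bsub>C\<^esub> Ident C A)
            \<cdot>\<^bsub>C\<^esub> ((proj1 C X Y \<cdot>\<^bsub>C\<^esub> f) \<otimes>\<^bsub>C\<^esub> Ident C A) \<cdot>\<^bsub>C\<^esub> copy C A)"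


section \<open>Almost sure equality and sample spaces\<close>

text \<open>Almost sure equality, for a state \<open>p : I \<rightarrow> X\<close>, as a relation on the morphisms \<open>X \<rightarrow> Y\<close>.\<close>

definition as_rel ::
  "('o, 'a, 'z) markov_data_scheme \<Rightarrow> 'o \<Rightarrow> 'o \<Rightarrow> 'a \<Rightarrow> ('a \<times> 'a) set" where
  "as_rel C X Y p =
     {(f, g). f \<in> hom C X Y \<and> g \<in> hom C X Y \<and>
        pairing C (Ident C X) f \<cdot>\<^bsub>C\<^esub> p = pairing C (Ident C X) g \<cdot>\<^bsub>C\<^esub> p}"

definition as_class ::
  "('o, 'a, 'z) markov_data_scheme \<Rightarrow> 'o \<Rightarrow> 'o \<Rightarrow> 'a \<Rightarrow> 'a \<Rightarrow> 'a set" where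
  "as_class C X Y p f = as_rel C X Y p `` {f}"

definition as_deterministic ::
  "('o, 'a, 'z) markov_data_scheme \<Rightarrow> 'o \<Rightarrow> 'o \<Rightarrow> 'a \<Rightarrow> 'a \<Rightarrow> bool" where
  "as_deterministic C X Y p f \<longleftrightarrow> f \<in> hom C X Y \<and>
     (copy C Y \<cdot>\<^bsub>C\<^esub> f, (f \<otimes>\<^bsub>C\<^esub> f) \<cdot>\<^bsub>C\<^esub> copy C X) \<in> as_rel C X (Y \<odot>\<^bsub>C\<^esub> Y) p"

text \<open>
  The composite \<open>[g \<circ> f]\<close> of the classes \<open>G = [g]\<close> and \<open>F = [f]\<close>. In a Markov category with
  conditionals all representatives yield the same class (for \<open>f\<close> state-preserving), and the
  union is that class.
\<close>

definition class_comp ::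
  "('o, 'a, 'z) markov_data_scheme \<Rightarrow> 'o \<Rightarrow> 'o \<Rightarrow> 'a \<Rightarrow> 'a set \<Rightarrow> 'a set \<Rightarrow> 'a set" where
  "class_comp C X Z p G F = (\<Union>g\<in>G. \<Union>f\<in>F. as_class C X Z p (g \<cdot>\<^bsub>C\<^esub> f))"

type_synonym ('o, 'a) sample_space = "'o \<times> 'a"

type_synonym ('o, 'a) sample_map =
  "('o, 'a) sample_space \<times> ('o, 'a) sample_space \<times> 'a set"

definition sample_cat ::
  "('o, 'a, 'z) markov_data_scheme \<Rightarrow> (('o, 'a) sample_space, ('o, 'a) sample_map) cat" where
  "sample_cat C =
     \<lparr>Obj = {(X, p). X \<in> Obj C \<and> p \<in> hom C \<I>\<^bsub>C\<^esub> X},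
      Arr = {((X, p), (Y, q), as_class C X Y p f) | X p Y q f.
               X \<in> Obj C \<and> p \<in> hom C \<I>\<^bsub>C\<^esub> X \<and> Y \<in> Obj C \<and> q \<in> hom C \<I>\<^bsub>C\<^esub> Y \<and>
               as_deterministic C X Y p f \<and> f \<cdot>\<^bsub>C\<^esub> p = q},
      Dom = (\<lambda>(A, B, F). A),
      Cod = (\<lambda>(A, B, F). B),
      Ident = (\<lambda>(X, p). ((X, p), (X, p), as_class C X X p (Ident C X))),
      Comp = (\<lambda>(B', (Z, r), G) ((X, p), B, F). ((X, p), (Z, r), class_comp C X Z p G F))\<rparr>"

definition RE ::
  "('o, 'a, 'z) markov_data_scheme \<Rightarrow> 'o \<Rightarrow>
     (('o, 'a) sample_space, ('o, 'a) sample_map, 'a set) presheaf_data" where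
  "RE C V =
     \<lparr>Sect = (\<lambda>(X, p). {as_class C X V p f | f. as_deterministic C X V p f}),
      Act = (\<lambda>F ((X, p), B, G). class_comp C X V p F G)\<rparr>"

end

theory Submission
  imports Defs
begin

text \<open>
  Let \<open>e : (X', q) \<rightarrow> (X, p)\<close> be a map of sample spaces and \<open>y\<close> an \<open>e\<close>-invariant random
  element on \<open>X'\<close>. A conditional of the joint state \<open>\<langle>id, e\<rangle> \<cdot> q\<close> is a Bayesian inverse
  \<open>s : X \<rightarrow> X'\<close>, characterised by \<open>\<langle>id, e\<rangle> \<cdot> q = \<langle>s, id\<rangle> \<cdot> p\<close> (\<open>bayesian_inverse\<close>): it draws
  a random point of the fibre of \<open>e\<close>. The descent of \<open>y\<close> is \<open>x = y \<cdot> s\<close>, the value of \<open>y\<close> at a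
  random point of the fibre. Invariance has to show that this value does not depend on the point.

  For this, draw two points independently in the same fibre: the sample space \<open>X' \<otimes> X'\<close> with
  the state \<open>r = \<langle>s, s\<rangle> \<cdot> p\<close>. Its two projections are deterministic and send \<open>r\<close> to \<open>q\<close>, so they are
  maps of sample spaces to \<open>(X', q)\<close>, and they agree almost surely after composition with \<open>e\<close>. Hence \<open>y\<close> takes
  almost surely the same value at both points. Comparing the value at the second point with the
  first point itself gives \<open>\<langle>id, y\<rangle> \<cdot> q = \<langle>id, y \<cdot> s \<cdot> e\<rangle> \<cdot> q\<close>, that is, \<open>y = x \<cdot> e\<close> almost surely
  (\<open>descent\<close>).

  Three facts make this work. Two morphisms whose joint law is concentrated on the diagonal are almost
  surely equal (\<open>as_rel_of_diagonal\<close>); the joint law of \<open>e\<close> at the two points is that of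
  \<open>\<langle>e \<cdot> s, e \<cdot> s\<rangle> \<cdot> p\<close>, and \<open>e \<cdot> s\<close> is almost surely the identity because \<open>e\<close> is almost surely
  deterministic. A map of sample spaces can be cancelled on the right up to almost sure equality
  (\<open>as_rel_cancel\<close>), which gives the uniqueness of \<open>x\<close> and also transfers almost sure determinism
  from \<open>y\<close> to \<open>x\<close> (\<open>as_deterministic_descend\<close>). Finally, Bayesian inverses show that precomposition
  respects almost sure equality (\<open>as_rel_comp_right\<close>), so that composition of classes is well
  defined. The representable presheaf of \<open>(V, v)\<close> consists of the random elements of \<open>V\<close> with law
  \<open>v\<close>, and \<open>x\<close> has the same law as \<open>y\<close>; so the same descent serves both presheaves.

  Most calculations use only the rules for the pairings \<open>\<langle>f, g\<rangle>\<close>, which hide the associators.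
  Monoidal coherence enters mainly in two statements about \<open>X \<otimes> Y\<close>: the projections are deterministic,
  and their pairing is the identity.
\<close>

section \<open>Typed composition\<close>

context category
begin

text \<open>
  The membership of \<open>X\<close> and \<open>Y\<close> lets simplification discharge the side conditions on objects
  that occur in the rules for structure arrows.
\<close>

lemma hom_iff:
  "f \<in> hom C X Y \<longleftrightarrow> f \<in> Arr C \<and> Dom C f = X \<and> Cod C f = Y \<and> X \<in> Obj C \<and> Y \<in> Obj C"
  using Dom_Obj Cod_Obj by (auto simp: hom_def)

declare Dom_Obj [simp] Cod_Obj [simp]

lemma Ident_type [simp]:
  assumes "X \<in> Obj C"
  shows "Ident C X \<in> Arr C" "Dom C (Ident C X) = X" "Cod C (Ident C X) = X"
  using Ident_hom[OF assms] by (auto simp: hom_def)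

lemma Comp_type [simp]:
  assumes "f \<in> Arr C" "g \<in> Arr C" "Dom C g = Cod C f"
  shows "g \<cdot> f \<in> Arr C" "Dom C (g \<cdot> f) = Dom C f" "Cod C (g \<cdot> f) = Cod C g"
  using Comp_hom[of f "Dom C f" "Cod C f" g "Cod C g"] assms by (auto simp: hom_def)

lemma comp_ident [simp]:
  "\<lbrakk>f \<in> Arr C; Cod C f = Y\<rbrakk> \<Longrightarrow> Ident C Y \<cdot> f = f"
  "\<lbrakk>f \<in> Arr C; Dom C f = X\<rbrakk> \<Longrightarrow> f \<cdot> Ident C X = f"
  using Comp_Ident_left Comp_Ident_right by (auto simp: hom_def)

lemma comp_assoc:
  "\<lbrakk>f \<in> Arr C; g \<in> Arr C; h \<in> Arr C; Dom C g = Cod C f; Dom C h = Cod C g\<rbrakk>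
     \<Longrightarrow> (h \<cdot> g) \<cdot> f = h \<cdot> (g \<cdot> f)"
  using Comp_assoc[of f "Dom C f" "Cod C f" g "Cod C g" h "Cod C h"] by (auto simp: hom_def)

lemma inverse_arrows_unique:
  assumes g: "inverse_arrows C f g" and h: "inverse_arrows C f h"
  shows "g = h"
proof -
  have f: "f \<in> Arr C" "g \<in> Arr C" "Dom C g = Cod C f" "Cod C g = Dom C f"
    "h \<in> Arr C" "Dom C h = Cod C f" "Cod C h = Dom C f"
    using g h by (auto simp: inverse_arrows_def hom_def)
  have "g = g \<cdot> (f \<cdot> h)" using f h by (simp add: inverse_arrows_def)
  also have "\<dots> = (g \<cdot> f) \<cdot> h" using f by (simp add: comp_assoc)
  also have "\<dots> = h" using f g by (simp add: inverse_arrows_def)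
  finally show ?thesis .
qed

lemma inverse_arrows_inv_arr: "is_iso C f \<Longrightarrow> inverse_arrows C f (inv_arr C f)"
  unfolding is_iso_def inv_arr_def using inverse_arrows_unique[of f]
  by (elim exE, intro theI'[of "inverse_arrows C f"]) blast

lemma inv_arr_type:
  assumes "is_iso C f"
  shows "inv_arr C f \<in> Arr C" "Dom C (inv_arr C f) = Cod C f" "Cod C (inv_arr C f) = Dom C f"
    "inv_arr C f \<cdot> f = Ident C (Dom C f)" "f \<cdot> inv_arr C f = Ident C (Cod C f)"
  using inverse_arrows_inv_arr[OF assms] by (auto simp: inverse_arrows_def hom_def)

lemma iso_Arr: "is_iso C f \<Longrightarrow> f \<in> Arr C"
  by (auto simp: is_iso_def inverse_arrows_def)

lemma is_iso_inv_arr: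
  assumes "is_iso C f"
  shows "is_iso C (inv_arr C f)"
proof -
  have "inverse_arrows C (inv_arr C f) f"
    using inv_arr_type[OF assms] iso_Arr[OF assms] by (simp add: inverse_arrows_def hom_iff)
  thus ?thesis by (auto simp: is_iso_def)
qed

lemma iso_cancel_right:
  assumes "f \<cdot> u = g \<cdot> u" "is_iso C u" "f \<in> Arr C" "g \<in> Arr C" "Dom C f = Cod C u" "Dom C g = Cod C u"
  shows "f = g"
proof -
  note i = inv_arr_type[OF assms(2)] iso_Arr[OF assms(2)]
  have "(f \<cdot> u) \<cdot> inv_arr C u = (g \<cdot> u) \<cdot> inv_arr C u" using assms(1) by simp
  thus ?thesis using assms(3-) i by (simp add: comp_assoc)
qed

lemma iso_cancel_left:
  assumes "u \<cdot> f = u \<cdot> g" "is_iso C u" "f \<in> Arr C" "g \<in> Arr C" "Cod C f = Dom C u" "Cod C g = Dom C u"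
  shows "f = g"
proof -
  note i = inv_arr_type[OF assms(2)] iso_Arr[OF assms(2)]
  have "inv_arr C u \<cdot> (u \<cdot> f) = inv_arr C u \<cdot> (u \<cdot> g)" using assms(1) by simp
  thus ?thesis using assms(3-) i by (simp add: comp_assoc[symmetric])
qed

end

lemma representable_simps [simp]:
  "Sect (representable S V) A = hom S A V"
  "Act (representable S V) x F = x \<cdot>\<^bsub>S\<^esub> F"
  by (simp_all add: representable_def)


section \<open>Coherence of symmetric monoidal categories\<close>

context symmetric_monoidal_category
begin

declare tensor_obj_Obj [simp] unit_Obj [simp] tensor_Ident [simp]

lemma tensor_type [simp]:
  assumes "f \<in> Arr C" "g \<in> Arr C"
  shows "f \<otimes> g \<in> Arr C" "Dom C (f \<otimes> g) = Dom C f \<odot> Dom C g" "Cod C (f \<otimes> g) = Cod C f \<odot> Cod C g"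
  using tensor_hom[of f "Dom C f" "Cod C f" g "Dom C g" "Cod C g"] assms by (auto simp: hom_def)

lemma structure_type [simp]:
  assumes "X \<in> Obj C"
  shows "lunit C X \<in> Arr C" "Dom C (lunit C X) = \<I> \<odot> X" "Cod C (lunit C X) = X"
    "runit C X \<in> Arr C" "Dom C (runit C X) = X \<odot> \<I>" "Cod C (runit C X) = X"
  using lunit_hom[OF assms] runit_hom[OF assms] by (auto simp: hom_def)

lemma swap_type [simp]:
  assumes "X \<in> Obj C" "Y \<in> Obj C"
  shows "swap C X Y \<in> Arr C" "Dom C (swap C X Y) = X \<odot> Y" "Cod C (swap C X Y) = Y \<odot> X"
  using swap_hom[OF assms] by (auto simp: hom_def)

lemma assoc_type [simp]:
  assumes "X \<in> Obj C" "Y \<in> Obj C" "Z \<in> Obj C"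
  shows "assoc C X Y Z \<in> Arr C" "Dom C (assoc C X Y Z) = (X \<odot> Y) \<odot> Z"
    "Cod C (assoc C X Y Z) = X \<odot> (Y \<odot> Z)"
  using assoc_hom[OF assms] by (auto simp: hom_def)

lemma inv_assoc_type [simp]:
  assumes "X \<in> Obj C" "Y \<in> Obj C" "Z \<in> Obj C"
  shows "inv_arr C (assoc C X Y Z) \<in> Arr C" "Dom C (inv_arr C (assoc C X Y Z)) = X \<odot> (Y \<odot> Z)"
    "Cod C (inv_arr C (assoc C X Y Z)) = (X \<odot> Y) \<odot> Z"
    "inv_arr C (assoc C X Y Z) \<cdot> assoc C X Y Z = Ident C ((X \<odot> Y) \<odot> Z)"
    "assoc C X Y Z \<cdot> inv_arr C (assoc C X Y Z) = Ident C (X \<odot> (Y \<odot> Z))"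
  using inv_arr_type[OF assoc_iso[OF assms]] assms by auto

lemma inv_assoc_assoc [simp]:
  assumes "X \<in> Obj C" "Y \<in> Obj C" "Z \<in> Obj C" "f \<in> Arr C" "Cod C f = (X \<odot> Y) \<odot> Z"
  shows "inv_arr C (assoc C X Y Z) \<cdot> (assoc C X Y Z \<cdot> f) = f"
  using assms by (simp add: comp_assoc[symmetric])

lemma tensor_comp:
  assumes "f \<in> Arr C" "g \<in> Arr C" "f' \<in> Arr C" "g' \<in> Arr C" "Dom C g = Cod C f" "Dom C g' = Cod C f'"
  shows "(g \<otimes> g') \<cdot> (f \<otimes> f') = (g \<cdot> f) \<otimes> (g' \<cdot> f')"
  using tensor_Comp[of f "Dom C f" "Cod C f" g "Cod C g" f' "Dom C f'" "Cod C f'" g' "Cod C g'"] assms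
  by (auto simp: hom_def)

text \<open>
  With composition associated to the right, adjacent tensors are usually followed by further
  arrows; this form of functoriality merges them without reassociating.
\<close>

lemma tensor_comp_tail:
  assumes "f \<in> Arr C" "g \<in> Arr C" "f' \<in> Arr C" "g' \<in> Arr C" "Dom C g = Cod C f" "Dom C g' = Cod C f'"
    "t \<in> Arr C" "Cod C t = Dom C f \<odot> Dom C f'"
  shows "(g \<otimes> g') \<cdot> ((f \<otimes> f') \<cdot> t) = ((g \<cdot> f) \<otimes> (g' \<cdot> f')) \<cdot> t"
  using assms by (simp add: comp_assoc[symmetric] tensor_comp)

lemma assoc_nat:
  assumes "f \<in> Arr C" "g \<in> Arr C" "h \<in> Arr C"
  shows "assoc C (Cod C f) (Cod C g) (Cod C h) \<cdot> ((f \<otimes> g) \<otimes> h)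
       = (f \<otimes> (g \<otimes> h)) \<cdot> assoc C (Dom C f) (Dom C g) (Dom C h)"
  using assms by (intro assoc_natural) (auto simp: hom_def)

lemma inv_assoc_nat:
  assumes "f \<in> Arr C" "g \<in> Arr C" "h \<in> Arr C"
  shows "inv_arr C (assoc C (Cod C f) (Cod C g) (Cod C h)) \<cdot> (f \<otimes> (g \<otimes> h))
       = ((f \<otimes> g) \<otimes> h) \<cdot> inv_arr C (assoc C (Dom C f) (Dom C g) (Dom C h))" (is "?l = ?r")
proof (rule iso_cancel_right)
  let ?a = "assoc C (Dom C f) (Dom C g) (Dom C h)"
  show "is_iso C ?a" using assms by (simp add: assoc_iso)
  have "?l \<cdot> ?a = inv_arr C (assoc C (Cod C f) (Cod C g) (Cod C h)) \<cdot> (f \<otimes> (g \<otimes> h)) \<cdot> ?a"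
    using assms by (simp add: comp_assoc)
  also have "\<dots> = (f \<otimes> g) \<otimes> h"
    using assms by (simp add: assoc_nat[symmetric])
  also have "\<dots> = ?r \<cdot> ?a" using assms by (simp add: comp_assoc)
  finally show "?l \<cdot> ?a = ?r \<cdot> ?a" .
qed (use assms in simp_all)

lemma swap_nat:
  assumes "f \<in> Arr C" "g \<in> Arr C"
  shows "swap C (Cod C f) (Cod C g) \<cdot> (f \<otimes> g) = (g \<otimes> f) \<cdot> swap C (Dom C f) (Dom C g)"
  using assms by (intro swap_natural) (auto simp: hom_def)

lemma runit_nat: "\<lbrakk>f \<in> Arr C; Cod C f = Y\<rbrakk> \<Longrightarrow> runit C Y \<cdot> (f \<otimes> Ident C \<I>) = f \<cdot> runit C (Dom C f)"
  and lunit_nat: "\<lbrakk>f \<in> Arr C; Cod C f = Y\<rbrakk> \<Longrightarrow> lunit C Y \<cdot> (Ident C \<I> \<otimes> f) = f \<cdot> lunit C (Dom C f)"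
  using runit_natural lunit_natural by (auto simp: hom_def)

lemma tensor_unit_faithful:
  assumes "f \<in> Arr C" "g \<in> Arr C" "Dom C f = Dom C g" "Cod C f = Cod C g"
  shows "f \<otimes> Ident C \<I> = g \<otimes> Ident C \<I> \<Longrightarrow> f = g"
    and "Ident C \<I> \<otimes> f = Ident C \<I> \<otimes> g \<Longrightarrow> f = g"
proof -
  assume "f \<otimes> Ident C \<I> = g \<otimes> Ident C \<I>"
  hence "f \<cdot> runit C (Dom C f) = g \<cdot> runit C (Dom C f)"
    using runit_nat[of f "Cod C f"] runit_nat[of g "Cod C f"] assms by simp
  thus "f = g" by (rule iso_cancel_right) (use assms in \<open>simp_all add: runit_iso\<close>)
next
  assume "Ident C \<I> \<otimes> f = Ident C \<I> \<otimes> g"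
  hence "f \<cdot> lunit C (Dom C f) = g \<cdot> lunit C (Dom C f)"
    using lunit_nat[of f "Cod C f"] lunit_nat[of g "Cod C f"] assms by simp
  thus "f = g" by (rule iso_cancel_right) (use assms in \<open>simp_all add: lunit_iso\<close>)
qed

text \<open>
  Two consequences of the pentagon and the triangle, due to Kelly. Each is proved after tensoring with
  the unit object, which is a faithful operation: there the pentagon with two adjacent units
  applies, and the associators are cancelled.
\<close>

lemma runit_tensor:
  assumes [simp]: "X \<in> Obj C" "Y \<in> Obj C"
  shows "(Ident C X \<otimes> runit C Y) \<cdot> assoc C X Y \<I> = runit C (X \<odot> Y)"
proof (rule tensor_unit_faithful(1))
  let ?l = "Ident C X \<otimes> (Ident C Y \<otimes> lunit C \<I>)"
  have "assoc C X Y \<I> \<cdot> (runit C (X \<odot> Y) \<otimes> Ident C \<I>)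
      = (assoc C X Y \<I> \<cdot> ((Ident C X \<otimes> Ident C Y) \<otimes> lunit C \<I>)) \<cdot> assoc C (X \<odot> Y) \<I> \<I>"
    by (simp add: triangle comp_assoc)
  also have "\<dots> = ?l \<cdot> (assoc C X Y (\<I> \<odot> \<I>) \<cdot> assoc C (X \<odot> Y) \<I> \<I>)"
    using assoc_nat[of "Ident C X" "Ident C Y" "lunit C \<I>"] by (simp add: comp_assoc)
  also have "\<dots> = ?l \<cdot> (Ident C X \<otimes> assoc C Y \<I> \<I>) \<cdot> assoc C X (Y \<odot> \<I>) \<I> \<cdot> (assoc C X Y \<I> \<otimes> Ident C \<I>)"
    by (simp add: pentagon)
  also have "\<dots> = ((Ident C X \<otimes> (runit C Y \<otimes> Ident C \<I>)) \<cdot> assoc C X (Y \<odot> \<I>) \<I>) \<cdot> (assoc C X Y \<I> \<otimes> Ident C \<I>)"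
    by (simp add: tensor_comp_tail triangle comp_assoc)
  also have "\<dots> = assoc C X Y \<I> \<cdot> ((Ident C X \<otimes> runit C Y) \<otimes> Ident C \<I>) \<cdot> (assoc C X Y \<I> \<otimes> Ident C \<I>)"
    using assoc_nat[of "Ident C X" "runit C Y" "Ident C \<I>"] by (simp add: comp_assoc[symmetric])
  also have "\<dots> = assoc C X Y \<I> \<cdot> (((Ident C X \<otimes> runit C Y) \<cdot> assoc C X Y \<I>) \<otimes> Ident C \<I>)"
    by (simp add: tensor_comp)
  finally show "((Ident C X \<otimes> runit C Y) \<cdot> assoc C X Y \<I>) \<otimes> Ident C \<I> = runit C (X \<odot> Y) \<otimes> Ident C \<I>"
    by (rule iso_cancel_left[symmetric, where u = "assoc C X Y \<I>"]) (simp_all add: assoc_iso)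
qed simp_all

lemma lunit_tensor:
  assumes [simp]: "X \<in> Obj C" "Y \<in> Obj C"
  shows "lunit C (X \<odot> Y) \<cdot> assoc C \<I> X Y = lunit C X \<otimes> Ident C Y"
proof (rule tensor_unit_faithful(2))
  let ?i = "Ident C \<I>" and ?a = "assoc C \<I> (\<I> \<odot> X) Y \<cdot> (assoc C \<I> \<I> X \<otimes> Ident C Y)"
  have "(?i \<otimes> (lunit C (X \<odot> Y) \<cdot> assoc C \<I> X Y)) \<cdot> ?a
      = (?i \<otimes> lunit C (X \<odot> Y)) \<cdot> (?i \<otimes> assoc C \<I> X Y) \<cdot> assoc C \<I> (\<I> \<odot> X) Y \<cdot> (assoc C \<I> \<I> X \<otimes> Ident C Y)"
    by (simp add: tensor_comp_tail)
  also have "\<dots> = (?i \<otimes> lunit C (X \<odot> Y)) \<cdot> assoc C \<I> \<I> (X \<odot> Y) \<cdot> assoc C (\<I> \<odot> \<I>) X Y"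
    by (simp add: pentagon)
  also have "\<dots> = ((?i \<otimes> lunit C (X \<odot> Y)) \<cdot> assoc C \<I> \<I> (X \<odot> Y)) \<cdot> assoc C (\<I> \<odot> \<I>) X Y"
    by (simp add: comp_assoc)
  also have "\<dots> = (runit C \<I> \<otimes> (Ident C X \<otimes> Ident C Y)) \<cdot> assoc C (\<I> \<odot> \<I>) X Y"
    by (simp add: triangle)
  also have "\<dots> = assoc C \<I> X Y \<cdot> ((runit C \<I> \<otimes> Ident C X) \<otimes> Ident C Y)"
    using assoc_nat[of "runit C \<I>" "Ident C X" "Ident C Y"] by simp
  also have "\<dots> = assoc C \<I> X Y \<cdot> ((?i \<otimes> lunit C X) \<otimes> Ident C Y) \<cdot> (assoc C \<I> \<I> X \<otimes> Ident C Y)"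
    by (simp add: tensor_comp triangle)
  also have "\<dots> = (?i \<otimes> (lunit C X \<otimes> Ident C Y)) \<cdot> ?a"
    using assoc_nat[of ?i "lunit C X" "Ident C Y"] by (simp add: comp_assoc[symmetric])
  finally have eq: "(?i \<otimes> (lunit C (X \<odot> Y) \<cdot> assoc C \<I> X Y)) \<cdot> ?a = (?i \<otimes> (lunit C X \<otimes> Ident C Y)) \<cdot> ?a" .
  have inv: "inverse_arrows C (assoc C \<I> \<I> X \<otimes> Ident C Y) (inv_arr C (assoc C \<I> \<I> X) \<otimes> Ident C Y)"
    by (simp add: inverse_arrows_def hom_iff tensor_comp)
  have "(?i \<otimes> (lunit C (X \<odot> Y) \<cdot> assoc C \<I> X Y)) \<cdot> assoc C \<I> (\<I> \<odot> X) Y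
      = (?i \<otimes> (lunit C X \<otimes> Ident C Y)) \<cdot> assoc C \<I> (\<I> \<odot> X) Y"
    by (rule iso_cancel_right[where u = "assoc C \<I> \<I> X \<otimes> Ident C Y"])
       (use eq inv in \<open>auto simp: comp_assoc is_iso_def\<close>)
  thus "?i \<otimes> (lunit C (X \<odot> Y) \<cdot> assoc C \<I> X Y) = ?i \<otimes> (lunit C X \<otimes> Ident C Y)"
    by (rule iso_cancel_right) (simp_all add: assoc_iso)
qed simp_all

text \<open>
  The interchange \<open>(W \<otimes> X) \<otimes> (Y \<otimes> Z) \<rightarrow> (W \<otimes> Y) \<otimes> (X \<otimes> Z)\<close> at four independent objects.
  The instance \<open>X X Y Y\<close> that occurs in the copying of \<open>X \<otimes> Y\<close> is not enough to express naturality: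
  deleting some of the factors replaces them by the unit.
\<close>

definition middle_four :: "'o \<Rightarrow> 'o \<Rightarrow> 'o \<Rightarrow> 'o \<Rightarrow> 'a" where
  "middle_four W X Y Z =
     inv_arr C (assoc C W Y (X \<odot> Z))
     \<cdot> (Ident C W \<otimes> (assoc C Y X Z \<cdot> (swap C X Y \<otimes> Ident C Z) \<cdot> inv_arr C (assoc C X Y Z)))
     \<cdot> assoc C W X (Y \<odot> Z)"

lemma middle_four_type [simp]:
  assumes "W \<in> Obj C" "X \<in> Obj C" "Y \<in> Obj C" "Z \<in> Obj C"
  shows "middle_four W X Y Z \<in> Arr C" "Dom C (middle_four W X Y Z) = (W \<odot> X) \<odot> (Y \<odot> Z)"
    "Cod C (middle_four W X Y Z) = (W \<odot> Y) \<odot> (X \<odot> Z)"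
  using assms by (simp_all add: middle_four_def)

lemma mid_swap_eq: "mid_swap C X Y = middle_four X X Y Y"
  by (simp add: mid_swap_def middle_four_def)

lemma middle_four_nat:
  assumes [simp]: "f \<in> Arr C" "g \<in> Arr C" "h \<in> Arr C" "k \<in> Arr C"
  shows "middle_four (Cod C f) (Cod C g) (Cod C h) (Cod C k) \<cdot> ((f \<otimes> g) \<otimes> (h \<otimes> k))
       = ((f \<otimes> h) \<otimes> (g \<otimes> k)) \<cdot> middle_four (Dom C f) (Dom C g) (Dom C h) (Dom C k)"
proof -
  let ?N' = "assoc C (Cod C h) (Cod C g) (Cod C k) \<cdot> (swap C (Cod C g) (Cod C h) \<otimes> Ident C (Cod C k))
      \<cdot> inv_arr C (assoc C (Cod C g) (Cod C h) (Cod C k))"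
  let ?N = "assoc C (Dom C h) (Dom C g) (Dom C k) \<cdot> (swap C (Dom C g) (Dom C h) \<otimes> Ident C (Dom C k))
      \<cdot> inv_arr C (assoc C (Dom C g) (Dom C h) (Dom C k))"
  let ?a' = "inv_arr C (assoc C (Cod C f) (Cod C h) (Cod C g \<odot> Cod C k))"
  let ?a = "inv_arr C (assoc C (Dom C f) (Dom C h) (Dom C g \<odot> Dom C k))"
  let ?b = "assoc C (Dom C f) (Dom C g) (Dom C h \<odot> Dom C k)"
  have "?N' \<cdot> (g \<otimes> (h \<otimes> k)) = assoc C (Cod C h) (Cod C g) (Cod C k) \<cdot> ((swap C (Cod C g) (Cod C h) \<cdot> (g \<otimes> h)) \<otimes> k)
      \<cdot> inv_arr C (assoc C (Dom C g) (Dom C h) (Dom C k))"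
    by (simp add: comp_assoc inv_assoc_nat tensor_comp_tail)
  also have "\<dots> = (assoc C (Cod C h) (Cod C g) (Cod C k) \<cdot> ((h \<otimes> g) \<otimes> k)) \<cdot> (swap C (Dom C g) (Dom C h) \<otimes> Ident C (Dom C k))
      \<cdot> inv_arr C (assoc C (Dom C g) (Dom C h) (Dom C k))"
    by (simp add: comp_assoc swap_nat tensor_comp_tail)
  also have "\<dots> = (h \<otimes> (g \<otimes> k)) \<cdot> ?N"
    by (simp add: comp_assoc assoc_nat)
  finally have N: "?N' \<cdot> (g \<otimes> (h \<otimes> k)) = (h \<otimes> (g \<otimes> k)) \<cdot> ?N" .
  have "middle_four (Cod C f) (Cod C g) (Cod C h) (Cod C k) \<cdot> ((f \<otimes> g) \<otimes> (h \<otimes> k))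
      = ?a' \<cdot> (Ident C (Cod C f) \<otimes> ?N') \<cdot> (f \<otimes> (g \<otimes> (h \<otimes> k))) \<cdot> ?b"
    using assoc_nat[of f g "h \<otimes> k"] by (simp add: middle_four_def comp_assoc)
  also have "\<dots> = ?a' \<cdot> (f \<otimes> (?N' \<cdot> (g \<otimes> (h \<otimes> k)))) \<cdot> ?b"
    by (simp add: tensor_comp_tail)
  also have "\<dots> = ?a' \<cdot> (f \<otimes> ((h \<otimes> (g \<otimes> k)) \<cdot> ?N)) \<cdot> ?b"
    by (simp only: N)
  also have "\<dots> = (?a' \<cdot> (f \<otimes> (h \<otimes> (g \<otimes> k)))) \<cdot> (Ident C (Dom C f) \<otimes> ?N) \<cdot> ?b"
    by (simp add: tensor_comp_tail comp_assoc)
  also have "\<dots> = (((f \<otimes> h) \<otimes> (g \<otimes> k)) \<cdot> ?a) \<cdot> (Ident C (Dom C f) \<otimes> ?N) \<cdot> ?b"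
    using inv_assoc_nat[of f h "g \<otimes> k"] by simp
  finally show ?thesis by (simp add: middle_four_def comp_assoc)
qed

end


section \<open>Pairings and projections\<close>

context markov_category
begin

abbreviation pair ("\<langle>_, _\<rangle>") where "\<langle>f, g\<rangle> \<equiv> pairing C f g"

definition deterministic :: "'a \<Rightarrow> bool" where
  "deterministic f \<longleftrightarrow> f \<in> Arr C \<and> copy C (Cod C f) \<cdot> f = \<langle>f, f\<rangle>"

definition proj2 :: "'o \<Rightarrow> 'o \<Rightarrow> 'a" where
  "proj2 X Y = lunit C Y \<cdot> (del C X \<otimes> Ident C Y)"

lemma copy_del_type [simp]:
  assumes "X \<in> Obj C"
  shows "copy C X \<in> Arr C" "Dom C (copy C X) = X" "Cod C (copy C X) = X \<odot> X"
    "del C X \<in> Arr C" "Dom C (del C X) = X" "Cod C (del C X) = \<I>"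
  using copy_hom[OF assms] del_hom[OF assms] by (auto simp: hom_def)

lemma del_comp [simp]: "\<lbrakk>f \<in> Arr C; Cod C f = X\<rbrakk> \<Longrightarrow> del C X \<cdot> f = del C (Dom C f)"
  using Cod_Obj[of f] by (intro unit_terminal[of "Dom C f"]) (auto simp: hom_def)

text \<open>
  Deleting one of two copies inverts the unitor. Together with the commutativity of copying this
  gives the compatibility of the unitors with the symmetry, below.
\<close>

lemma inv_runit: "X \<in> Obj C \<Longrightarrow> inv_arr C (runit C X) = (Ident C X \<otimes> del C X) \<cdot> copy C X"
  by (rule iso_cancel_left[where u = "runit C X"])
     (simp_all add: runit_iso copy_counit_right inv_arr_type[OF runit_iso])

lemma runit_unit: "runit C \<I> = lunit C \<I>"
proof -
  note i = inv_arr_type[OF lunit_iso[OF unit_Obj]]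
  have "runit C \<I> \<cdot> inv_arr C (lunit C \<I>) = lunit C \<I> \<cdot> inv_arr C (lunit C \<I>)"
    using copy_counit_right[of \<I>] i by (simp add: del_unit copy_unit)
  thus ?thesis
    by (rule iso_cancel_right) (use i in \<open>simp_all add: is_iso_inv_arr lunit_iso\<close>)
qed

lemma lunit_copy_unit: "lunit C \<I> \<cdot> copy C \<I> = Ident C \<I>"
  using inv_arr_type[OF lunit_iso[of \<I>]] by (simp add: copy_unit)

lemma lunit_swap:
  assumes X [simp]: "X \<in> Obj C"
  shows "lunit C X \<cdot> swap C X \<I> = runit C X"
proof -
  let ?u = "(Ident C X \<otimes> del C X) \<cdot> copy C X"
  have "(lunit C X \<cdot> swap C X \<I>) \<cdot> ?u = lunit C X \<cdot> (swap C X \<I> \<cdot> (Ident C X \<otimes> del C X)) \<cdot> copy C X"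
    by (simp add: comp_assoc)
  also have "\<dots> = lunit C X \<cdot> (del C X \<otimes> Ident C X) \<cdot> (swap C X X \<cdot> copy C X)"
    using swap_nat[of "Ident C X" "del C X"] by (simp add: comp_assoc)
  also have "\<dots> = runit C X \<cdot> ?u"
    by (simp add: copy_commute copy_counit_left copy_counit_right)
  finally show ?thesis
    by (rule iso_cancel_right)
       (simp_all add: is_iso_inv_arr runit_iso inv_runit[symmetric, OF X] inv_arr_type[OF runit_iso[OF X]])
qed

lemma runit_swap:
  assumes [simp]: "X \<in> Obj C"
  shows "runit C X \<cdot> swap C \<I> X = lunit C X"
  by (simp add: lunit_swap[symmetric] comp_assoc swap_swap)

lemma swap_unit: "swap C \<I> \<I> = Ident C (\<I> \<odot> \<I>)"
  by (rule iso_cancel_left[where u = "lunit C \<I>"]) (simp_all add: lunit_swap runit_unit lunit_iso)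

lemma pairing_type [simp]:
  assumes "f \<in> Arr C" "g \<in> Arr C" "Dom C g = Dom C f"
  shows "\<langle>f, g\<rangle> \<in> Arr C" "Dom C \<langle>f, g\<rangle> = Dom C f" "Cod C \<langle>f, g\<rangle> = Cod C f \<odot> Cod C g"
  using assms by (simp_all add: pairing_def)

lemma copy_eq_pairing: "X \<in> Obj C \<Longrightarrow> copy C X = \<langle>Ident C X, Ident C X\<rangle>"
  by (simp add: pairing_def)

lemma tensor_pairing:
  assumes "f \<in> Arr C" "g \<in> Arr C" "Dom C g = Dom C f"
    "h \<in> Arr C" "k \<in> Arr C" "Dom C h = Cod C f" "Dom C k = Cod C g"
  shows "(h \<otimes> k) \<cdot> \<langle>f, g\<rangle> = \<langle>h \<cdot> f, k \<cdot> g\<rangle>"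
  using assms by (simp add: pairing_def tensor_comp_tail)

lemma swap_pairing:
  assumes "f \<in> Arr C" "g \<in> Arr C" "Dom C g = Dom C f"
  shows "swap C (Cod C f) (Cod C g) \<cdot> \<langle>f, g\<rangle> = \<langle>g, f\<rangle>"
proof -
  have "swap C (Cod C f) (Cod C g) \<cdot> \<langle>f, g\<rangle> = (swap C (Cod C f) (Cod C g) \<cdot> (f \<otimes> g)) \<cdot> copy C (Dom C f)"
    using assms by (simp add: pairing_def comp_assoc)
  also have "\<dots> = (g \<otimes> f) \<cdot> (swap C (Dom C f) (Dom C f) \<cdot> copy C (Dom C f))"
    using assms by (simp add: swap_nat comp_assoc)
  finally show ?thesis using assms by (simp add: copy_commute pairing_def)
qed

lemma assoc_pairing:
  assumes "f \<in> Arr C" "g \<in> Arr C" "h \<in> Arr C" "Dom C g = Dom C f" "Dom C h = Dom C f"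
  shows "assoc C (Cod C f) (Cod C g) (Cod C h) \<cdot> \<langle>\<langle>f, g\<rangle>, h\<rangle> = \<langle>f, \<langle>g, h\<rangle>\<rangle>"
proof -
  let ?A = "Dom C f"
  have "assoc C (Cod C f) (Cod C g) (Cod C h) \<cdot> \<langle>\<langle>f, g\<rangle>, h\<rangle>
      = (assoc C (Cod C f) (Cod C g) (Cod C h) \<cdot> ((f \<otimes> g) \<otimes> h)) \<cdot> (copy C ?A \<otimes> Ident C ?A) \<cdot> copy C ?A"
    using assms by (simp add: pairing_def comp_assoc tensor_comp_tail)
  also have "\<dots> = (f \<otimes> (g \<otimes> h)) \<cdot> (assoc C ?A ?A ?A \<cdot> (copy C ?A \<otimes> Ident C ?A) \<cdot> copy C ?A)"
    using assms by (simp add: assoc_nat comp_assoc)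
  also have "\<dots> = (f \<otimes> (g \<otimes> h)) \<cdot> (Ident C ?A \<otimes> copy C ?A) \<cdot> copy C ?A"
    using assms by (simp add: copy_coassoc)
  finally show ?thesis using assms by (simp add: pairing_def tensor_comp_tail)
qed

lemma inv_assoc_pairing:
  assumes "f \<in> Arr C" "g \<in> Arr C" "h \<in> Arr C" "Dom C g = Dom C f" "Dom C h = Dom C f"
  shows "inv_arr C (assoc C (Cod C f) (Cod C g) (Cod C h)) \<cdot> \<langle>f, \<langle>g, h\<rangle>\<rangle> = \<langle>\<langle>f, g\<rangle>, h\<rangle>"
  using assms by (simp add: assoc_pairing[symmetric])

text \<open>
  The interchange is composed of rebracketings and a symmetry, each of which acts on pairings as it does
  on tuples of elements.
\<close>

lemma middle_four_pairing:
  assumes [simp]: "a \<in> Arr C" "b \<in> Arr C" "c \<in> Arr C" "d \<in> Arr C"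
    and [simp]: "Dom C b = Dom C a" "Dom C c = Dom C a" "Dom C d = Dom C a"
  shows "middle_four (Cod C a) (Cod C b) (Cod C c) (Cod C d) \<cdot> \<langle>\<langle>a, b\<rangle>, \<langle>c, d\<rangle>\<rangle> = \<langle>\<langle>a, c\<rangle>, \<langle>b, d\<rangle>\<rangle>"
proof -
  let ?N = "assoc C (Cod C c) (Cod C b) (Cod C d) \<cdot> (swap C (Cod C b) (Cod C c) \<otimes> Ident C (Cod C d))
      \<cdot> inv_arr C (assoc C (Cod C b) (Cod C c) (Cod C d))"
  have N: "?N \<cdot> \<langle>b, \<langle>c, d\<rangle>\<rangle> = \<langle>c, \<langle>b, d\<rangle>\<rangle>"
    by (simp add: comp_assoc inv_assoc_pairing tensor_pairing swap_pairing assoc_pairing)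
  have "assoc C (Cod C a) (Cod C b) (Cod C c \<odot> Cod C d) \<cdot> \<langle>\<langle>a, b\<rangle>, \<langle>c, d\<rangle>\<rangle> = \<langle>a, \<langle>b, \<langle>c, d\<rangle>\<rangle>\<rangle>"
    using assoc_pairing[of a b "\<langle>c, d\<rangle>"] by simp
  hence "middle_four (Cod C a) (Cod C b) (Cod C c) (Cod C d) \<cdot> \<langle>\<langle>a, b\<rangle>, \<langle>c, d\<rangle>\<rangle>
      = inv_arr C (assoc C (Cod C a) (Cod C c) (Cod C b \<odot> Cod C d)) \<cdot> \<langle>a, ?N \<cdot> \<langle>b, \<langle>c, d\<rangle>\<rangle>\<rangle>"
    by (simp add: middle_four_def comp_assoc tensor_pairing)
  also have "\<dots> = \<langle>\<langle>a, c\<rangle>, \<langle>b, d\<rangle>\<rangle>"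
    using inv_assoc_pairing[of a c "\<langle>b, d\<rangle>"] unfolding N by simp
  finally show ?thesis .
qed

lemma pairing_comp_deterministic:
  assumes "deterministic d" "f \<in> Arr C" "g \<in> Arr C" "Dom C f = Cod C d" "Dom C g = Cod C d"
  shows "\<langle>f, g\<rangle> \<cdot> d = \<langle>f \<cdot> d, g \<cdot> d\<rangle>"
proof -
  have "\<langle>f, g\<rangle> \<cdot> d = (f \<otimes> g) \<cdot> (copy C (Cod C d) \<cdot> d)"
    using assms by (simp add: deterministic_def pairing_def comp_assoc)
  also have "\<dots> = \<langle>f \<cdot> d, g \<cdot> d\<rangle>"
    using assms by (simp add: deterministic_def tensor_pairing)
  finally show ?thesis .
qed

text \<open>
  Copying twice gives four copies, which the interchange permutes without effect.
\<close>

lemma deterministic_copy: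
  assumes [simp]: "X \<in> Obj C"
  shows "deterministic (copy C X)"
proof -
  let ?i = "Ident C X"
  have "copy C (X \<odot> X) \<cdot> copy C X = middle_four X X X X \<cdot> \<langle>\<langle>?i, ?i\<rangle>, \<langle>?i, ?i\<rangle>\<rangle>"
    by (simp add: copy_tensor mid_swap_eq comp_assoc pairing_def)
  also have "\<dots> = \<langle>copy C X, copy C X\<rangle>"
    using middle_four_pairing[of ?i ?i ?i ?i] by (simp add: copy_eq_pairing)
  finally show ?thesis by (simp add: deterministic_def)
qed

lemma proj_type [simp]:
  assumes "X \<in> Obj C" "Y \<in> Obj C"
  shows "proj1 C X Y \<in> Arr C" "Dom C (proj1 C X Y) = X \<odot> Y" "Cod C (proj1 C X Y) = X"
    "proj2 X Y \<in> Arr C" "Dom C (proj2 X Y) = X \<odot> Y" "Cod C (proj2 X Y) = Y"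
  using assms by (simp_all add: proj1_def proj2_def)

lemma proj_pairing:
  assumes [simp]: "f \<in> Arr C" "g \<in> Arr C" "Dom C g = Dom C f" "Cod C f = X" "Cod C g = Y"
    and [simp]: "X \<in> Obj C" "Y \<in> Obj C"
  shows "proj1 C X Y \<cdot> \<langle>f, g\<rangle> = f" "proj2 X Y \<cdot> \<langle>f, g\<rangle> = g"
proof -
  let ?A = "Dom C f"
  have "proj1 C X Y \<cdot> \<langle>f, g\<rangle> = (runit C X \<cdot> (f \<otimes> Ident C \<I>)) \<cdot> (Ident C ?A \<otimes> del C ?A) \<cdot> copy C ?A"
    by (simp add: proj1_def comp_assoc tensor_pairing) (simp add: pairing_def tensor_comp_tail)
  also have "\<dots> = f \<cdot> (runit C ?A \<cdot> (Ident C ?A \<otimes> del C ?A) \<cdot> copy C ?A)"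
    by (simp add: runit_nat comp_assoc)
  finally show "proj1 C X Y \<cdot> \<langle>f, g\<rangle> = f" by (simp add: copy_counit_right)
  have "proj2 X Y \<cdot> \<langle>f, g\<rangle> = (lunit C Y \<cdot> (Ident C \<I> \<otimes> g)) \<cdot> (del C ?A \<otimes> Ident C ?A) \<cdot> copy C ?A"
    by (simp add: proj2_def comp_assoc tensor_pairing) (simp add: pairing_def tensor_comp_tail)
  also have "\<dots> = g \<cdot> (lunit C ?A \<cdot> (del C ?A \<otimes> Ident C ?A) \<cdot> copy C ?A)"
    by (simp add: lunit_nat comp_assoc)
  finally show "proj2 X Y \<cdot> \<langle>f, g\<rangle> = g" by (simp add: copy_counit_left)
qed

lemma middle_four_units:
  assumes [simp]: "X \<in> Obj C" "Y \<in> Obj C"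
  shows "middle_four X \<I> \<I> Y = Ident C ((X \<odot> \<I>) \<odot> (\<I> \<odot> Y))"
  by (simp add: middle_four_def swap_unit)

text \<open>
  If both units stand on the right, the interchange only moves them past \<open>Y\<close>, and by coherence the
  unitors absorb it. This and the mirrored statement reduce the determinism of the projections to the
  naturality of the interchange.
\<close>

lemma runit_runit_middle_four:
  assumes [simp]: "X \<in> Obj C" "Y \<in> Obj C"
  shows "(runit C X \<otimes> runit C Y) \<cdot> middle_four X Y \<I> \<I> = runit C (X \<odot> Y) \<cdot> (Ident C (X \<odot> Y) \<otimes> lunit C \<I>)"
proof -
  let ?N = "assoc C \<I> Y \<I> \<cdot> (swap C Y \<I> \<otimes> Ident C \<I>) \<cdot> inv_arr C (assoc C Y \<I> \<I>)"
  have 1: "(runit C X \<otimes> runit C Y) \<cdot> inv_arr C (assoc C X \<I> (Y \<odot> \<I>)) = Ident C X \<otimes> (runit C Y \<cdot> lunit C (Y \<odot> \<I>))"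
  proof -
    have "runit C X \<otimes> runit C Y = (Ident C X \<otimes> runit C Y) \<cdot> (runit C X \<otimes> Ident C (Y \<odot> \<I>))"
      by (simp add: tensor_comp)
    also have "\<dots> = (Ident C X \<otimes> (runit C Y \<cdot> lunit C (Y \<odot> \<I>))) \<cdot> assoc C X \<I> (Y \<odot> \<I>)"
      by (simp add: triangle[symmetric] tensor_comp_tail)
    finally show ?thesis by (simp add: comp_assoc)
  qed
  have "(runit C Y \<cdot> lunit C (Y \<odot> \<I>)) \<cdot> ?N
      = runit C Y \<cdot> (lunit C (Y \<odot> \<I>) \<cdot> assoc C \<I> Y \<I>) \<cdot> (swap C Y \<I> \<otimes> Ident C \<I>) \<cdot> inv_arr C (assoc C Y \<I> \<I>)"
    by (simp add: comp_assoc)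
  also have "\<dots> = runit C Y \<cdot> (runit C Y \<otimes> Ident C \<I>) \<cdot> inv_arr C (assoc C Y \<I> \<I>)"
    by (simp add: lunit_tensor tensor_comp_tail lunit_swap)
  also have "\<dots> = runit C Y \<cdot> (Ident C Y \<otimes> lunit C \<I>)"
    by (simp add: triangle[symmetric] comp_assoc)
  finally have 2: "(runit C Y \<cdot> lunit C (Y \<odot> \<I>)) \<cdot> ?N = runit C Y \<cdot> (Ident C Y \<otimes> lunit C \<I>)" .
  have "(runit C X \<otimes> runit C Y) \<cdot> middle_four X Y \<I> \<I>
      = ((runit C X \<otimes> runit C Y) \<cdot> inv_arr C (assoc C X \<I> (Y \<odot> \<I>))) \<cdot> (Ident C X \<otimes> ?N) \<cdot> assoc C X Y (\<I> \<odot> \<I>)"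
    by (simp add: middle_four_def comp_assoc)
  also have "\<dots> = (Ident C X \<otimes> ((runit C Y \<cdot> lunit C (Y \<odot> \<I>)) \<cdot> ?N)) \<cdot> assoc C X Y (\<I> \<odot> \<I>)"
    unfolding 1 by (simp add: tensor_comp_tail)
  also have "\<dots> = (Ident C X \<otimes> runit C Y) \<cdot> ((Ident C X \<otimes> (Ident C Y \<otimes> lunit C \<I>)) \<cdot> assoc C X Y (\<I> \<odot> \<I>))"
    unfolding 2 by (simp add: tensor_comp_tail)
  also have "\<dots> = ((Ident C X \<otimes> runit C Y) \<cdot> assoc C X Y \<I>) \<cdot> (Ident C (X \<odot> Y) \<otimes> lunit C \<I>)"
    using assoc_nat[of "Ident C X" "Ident C Y" "lunit C \<I>"] by (simp add: comp_assoc)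
  finally show ?thesis by (simp add: runit_tensor)
qed

lemma lunit_lunit_middle_four:
  assumes [simp]: "X \<in> Obj C" "Y \<in> Obj C"
  shows "(lunit C X \<otimes> lunit C Y) \<cdot> middle_four \<I> \<I> X Y = lunit C (X \<odot> Y) \<cdot> (lunit C \<I> \<otimes> Ident C (X \<odot> Y))"
proof -
  let ?N = "assoc C X \<I> Y \<cdot> (swap C \<I> X \<otimes> Ident C Y) \<cdot> inv_arr C (assoc C \<I> X Y)"
  have 1: "(lunit C X \<otimes> lunit C Y) \<cdot> inv_arr C (assoc C \<I> X (\<I> \<odot> Y))
      = lunit C (X \<odot> Y) \<cdot> (Ident C \<I> \<otimes> (Ident C X \<otimes> lunit C Y))"
  proof -
    have "lunit C X \<otimes> lunit C Y = (Ident C X \<otimes> lunit C Y) \<cdot> (lunit C X \<otimes> Ident C (\<I> \<odot> Y))"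
      by (simp add: tensor_comp)
    also have "\<dots> = ((Ident C X \<otimes> lunit C Y) \<cdot> lunit C (X \<odot> (\<I> \<odot> Y))) \<cdot> assoc C \<I> X (\<I> \<odot> Y)"
      by (simp add: lunit_tensor[symmetric] comp_assoc)
    finally show ?thesis by (simp add: comp_assoc lunit_nat)
  qed
  have "(Ident C X \<otimes> lunit C Y) \<cdot> ?N
      = ((Ident C X \<otimes> lunit C Y) \<cdot> assoc C X \<I> Y) \<cdot> (swap C \<I> X \<otimes> Ident C Y) \<cdot> inv_arr C (assoc C \<I> X Y)"
    by (simp add: comp_assoc)
  also have "\<dots> = (lunit C X \<otimes> Ident C Y) \<cdot> inv_arr C (assoc C \<I> X Y)"
    by (simp add: triangle tensor_comp_tail runit_swap)
  also have "\<dots> = lunit C (X \<odot> Y)"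
    by (simp add: lunit_tensor[symmetric] comp_assoc)
  finally have 2: "(Ident C X \<otimes> lunit C Y) \<cdot> ?N = lunit C (X \<odot> Y)" .
  have "(lunit C X \<otimes> lunit C Y) \<cdot> middle_four \<I> \<I> X Y
      = ((lunit C X \<otimes> lunit C Y) \<cdot> inv_arr C (assoc C \<I> X (\<I> \<odot> Y))) \<cdot> (Ident C \<I> \<otimes> ?N) \<cdot> assoc C \<I> \<I> (X \<odot> Y)"
    by (simp add: middle_four_def comp_assoc)
  also have "\<dots> = lunit C (X \<odot> Y) \<cdot> (Ident C \<I> \<otimes> ((Ident C X \<otimes> lunit C Y) \<cdot> ?N)) \<cdot> assoc C \<I> \<I> (X \<odot> Y)"
    unfolding 1 by (simp add: tensor_comp_tail comp_assoc)
  also have "\<dots> = lunit C (X \<odot> Y) \<cdot> (lunit C \<I> \<otimes> Ident C (X \<odot> Y))"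
    unfolding 2 by (simp add: triangle runit_unit)
  finally show ?thesis .
qed

lemma copy_del_natural:
  assumes [simp]: "X \<in> Obj C"
  shows "(del C X \<otimes> del C X) \<cdot> copy C X = copy C \<I> \<cdot> del C X"
proof (rule iso_cancel_left[where u = "lunit C \<I>"])
  show "lunit C \<I> \<cdot> (del C X \<otimes> del C X) \<cdot> copy C X = lunit C \<I> \<cdot> copy C \<I> \<cdot> del C X"
    by (rule unit_terminal[of X]) (simp_all add: hom_iff)
qed (simp_all add: lunit_iso)

text \<open>
  The arrow on the left deletes the two middle factors of the interchanged copies. By naturality they
  can be deleted before the interchange, which is then the identity since it only swaps two units; what
  remains is the counit law in each factor.
\<close>

lemma pairing_proj1_proj2:
  assumes [simp]: "X \<in> Obj C" "Y \<in> Obj C"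
  shows "\<langle>proj1 C X Y, proj2 X Y\<rangle> = Ident C (X \<odot> Y)"
proof -
  let ?x = "Ident C X \<otimes> del C X" and ?y = "del C Y \<otimes> Ident C Y"
  have "\<langle>proj1 C X Y, proj2 X Y\<rangle>
      = (runit C X \<otimes> lunit C Y) \<cdot> (((Ident C X \<otimes> del C Y) \<otimes> (del C X \<otimes> Ident C Y)) \<cdot> middle_four X X Y Y) \<cdot> (copy C X \<otimes> copy C Y)"
    by (simp add: pairing_def proj1_def proj2_def copy_tensor mid_swap_eq comp_assoc tensor_comp_tail)
  also have "\<dots> = (runit C X \<otimes> lunit C Y) \<cdot> (middle_four X \<I> \<I> Y \<cdot> (?x \<otimes> ?y)) \<cdot> (copy C X \<otimes> copy C Y)"
    using middle_four_nat[of "Ident C X" "del C X" "del C Y" "Ident C Y"] by simp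
  also have "\<dots> = Ident C (X \<odot> Y)"
    by (simp add: middle_four_units comp_assoc tensor_comp copy_counit_left copy_counit_right)
  finally show ?thesis .
qed

text \<open>
  Deleting both copies of \<open>Y\<close> is copying the deletion of \<open>Y\<close>, and the unit left over is absorbed by the
  unitors.
\<close>

lemma deterministic_proj1:
  assumes [simp]: "X \<in> Obj C" "Y \<in> Obj C"
  shows "deterministic (proj1 C X Y)"
proof -
  have "\<langle>proj1 C X Y, proj1 C X Y\<rangle>
      = (runit C X \<otimes> runit C X) \<cdot> (((Ident C X \<otimes> del C Y) \<otimes> (Ident C X \<otimes> del C Y)) \<cdot> middle_four X X Y Y) \<cdot> (copy C X \<otimes> copy C Y)"
    by (simp add: pairing_def proj1_def copy_tensor mid_swap_eq comp_assoc tensor_comp_tail)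
  also have "\<dots> = ((runit C X \<otimes> runit C X) \<cdot> middle_four X X \<I> \<I>) \<cdot> (copy C X \<otimes> ((del C Y \<otimes> del C Y) \<cdot> copy C Y))"
    using middle_four_nat[of "Ident C X" "Ident C X" "del C Y" "del C Y", symmetric]
    by (simp add: comp_assoc tensor_comp)
  also have "\<dots> = runit C (X \<odot> X) \<cdot> (copy C X \<otimes> ((lunit C \<I> \<cdot> copy C \<I>) \<cdot> del C Y))"
    by (simp add: runit_runit_middle_four copy_del_natural comp_assoc tensor_comp)
  also have "\<dots> = (runit C (X \<odot> X) \<cdot> (copy C X \<otimes> Ident C \<I>)) \<cdot> (Ident C X \<otimes> del C Y)"
    by (simp add: lunit_copy_unit comp_assoc tensor_comp)
  also have "\<dots> = copy C X \<cdot> proj1 C X Y"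
    by (simp add: runit_nat proj1_def comp_assoc)
  finally show ?thesis by (simp add: deterministic_def)
qed

lemma deterministic_proj2:
  assumes [simp]: "X \<in> Obj C" "Y \<in> Obj C"
  shows "deterministic (proj2 X Y)"
proof -
  have "\<langle>proj2 X Y, proj2 X Y\<rangle>
      = (lunit C Y \<otimes> lunit C Y) \<cdot> (((del C X \<otimes> Ident C Y) \<otimes> (del C X \<otimes> Ident C Y)) \<cdot> middle_four X X Y Y) \<cdot> (copy C X \<otimes> copy C Y)"
    by (simp add: pairing_def proj2_def copy_tensor mid_swap_eq comp_assoc tensor_comp_tail)
  also have "\<dots> = ((lunit C Y \<otimes> lunit C Y) \<cdot> middle_four \<I> \<I> Y Y) \<cdot> (((del C X \<otimes> del C X) \<cdot> copy C X) \<otimes> copy C Y)"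
    using middle_four_nat[of "del C X" "del C X" "Ident C Y" "Ident C Y", symmetric]
    by (simp add: comp_assoc tensor_comp)
  also have "\<dots> = lunit C (Y \<odot> Y) \<cdot> (((lunit C \<I> \<cdot> copy C \<I>) \<cdot> del C X) \<otimes> copy C Y)"
    by (simp add: lunit_lunit_middle_four copy_del_natural comp_assoc tensor_comp)
  also have "\<dots> = (lunit C (Y \<odot> Y) \<cdot> (Ident C \<I> \<otimes> copy C Y)) \<cdot> (del C X \<otimes> Ident C Y)"
    by (simp add: lunit_copy_unit comp_assoc tensor_comp)
  also have "\<dots> = copy C Y \<cdot> proj2 X Y"
    by (simp add: lunit_nat proj2_def comp_assoc)
  finally show ?thesis by (simp add: deterministic_def)
qed


section \<open>Almost sure equality\<close>

lemma as_rel_refl: "f \<in> hom C X Y \<Longrightarrow> (f, f) \<in> as_rel C X Y p"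
  by (simp add: as_rel_def)

lemma as_rel_sym: "(f, g) \<in> as_rel C X Y p \<Longrightarrow> (g, f) \<in> as_rel C X Y p"
  by (simp add: as_rel_def)

lemma as_rel_trans:
  "\<lbrakk>(f, g) \<in> as_rel C X Y p; (g, h) \<in> as_rel C X Y p\<rbrakk> \<Longrightarrow> (f, h) \<in> as_rel C X Y p"
  by (simp add: as_rel_def)

lemma as_rel_hom: "(f, g) \<in> as_rel C X Y p \<Longrightarrow> f \<in> hom C X Y \<and> g \<in> hom C X Y"
  by (simp add: as_rel_def)

text \<open>
  Almost sure equality is about joint laws with the sample point; any further \<open>k\<close> is
  obtained by applying an arrow to that point.
\<close>

lemma as_rel_joint:
  assumes fg: "(f, g) \<in> as_rel C X Y p" and p: "p \<in> hom C \<I> X" and k: "k \<in> hom C X Z"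
  shows "\<langle>k, f\<rangle> \<cdot> p = \<langle>k, g\<rangle> \<cdot> p"
proof -
  have eq: "\<langle>Ident C X, f\<rangle> \<cdot> p = \<langle>Ident C X, g\<rangle> \<cdot> p" using fg by (simp add: as_rel_def)
  have *: "\<langle>k, h\<rangle> \<cdot> p = (k \<otimes> Ident C Y) \<cdot> \<langle>Ident C X, h\<rangle> \<cdot> p" if "h \<in> hom C X Y" for h
    using that p k by (simp add: hom_iff comp_assoc[symmetric] tensor_pairing)
  show ?thesis using as_rel_hom[OF fg] by (simp add: * eq)
qed

lemma as_rel_state:
  assumes fg: "(f, g) \<in> as_rel C X Y p" and p: "p \<in> hom C \<I> X"
  shows "f \<cdot> p = g \<cdot> p"
proof -
  have eq: "\<langle>Ident C X, f\<rangle> \<cdot> p = \<langle>Ident C X, g\<rangle> \<cdot> p" using fg by (simp add: as_rel_def)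
  have *: "h \<cdot> p = proj2 X Y \<cdot> \<langle>Ident C X, h\<rangle> \<cdot> p" if "h \<in> hom C X Y" for h
    using that p by (simp add: hom_iff comp_assoc[symmetric] proj_pairing)
  show ?thesis using as_rel_hom[OF fg] by (simp add: * eq)
qed

lemma as_rel_comp_left:
  assumes fg: "(f, g) \<in> as_rel C X Y p" and p: "p \<in> hom C \<I> X" and k: "k \<in> hom C Y Z"
  shows "(k \<cdot> f, k \<cdot> g) \<in> as_rel C X Z p"
proof -
  have eq: "\<langle>Ident C X, f\<rangle> \<cdot> p = \<langle>Ident C X, g\<rangle> \<cdot> p" using fg by (simp add: as_rel_def)
  have *: "\<langle>Ident C X, k \<cdot> h\<rangle> \<cdot> p = (Ident C X \<otimes> k) \<cdot> \<langle>Ident C X, h\<rangle> \<cdot> p" if "h \<in> hom C X Y" for h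
    using that p k by (simp add: hom_iff comp_assoc[symmetric] tensor_pairing)
  have "f \<in> hom C X Y" "g \<in> hom C X Y" using as_rel_hom[OF fg] by auto
  thus ?thesis using p k eq by (simp add: as_rel_def * Comp_hom)
qed

lemma pairing_hom:
  "\<lbrakk>f \<in> hom C X Y; g \<in> hom C X Z\<rbrakk> \<Longrightarrow> \<langle>f, g\<rangle> \<in> hom C X (Y \<odot> Z)"
  by (simp add: hom_iff)

text \<open>
  The sample point has to be used a second time, to compute \<open>k\<close>: it is copied in the common joint law of
  \<open>f\<close> and \<open>g\<close> with the sample point, and \<open>k\<close> is applied to the additional copy.
\<close>

lemma as_rel_pairing_left:
  assumes fg: "(f, g) \<in> as_rel C X Y p" and p: "p \<in> hom C \<I> X" and k: "k \<in> hom C X Z"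
  shows "(\<langle>f, k\<rangle>, \<langle>g, k\<rangle>) \<in> as_rel C X (Y \<odot> Z) p"
proof -
  let ?i = "Ident C X"
  have eq: "\<langle>?i, f\<rangle> \<cdot> p = \<langle>?i, g\<rangle> \<cdot> p" using fg by (simp add: as_rel_def)
  have *: "\<langle>?i, \<langle>h, k\<rangle>\<rangle> \<cdot> p
      = (?i \<otimes> ((Ident C Y \<otimes> k) \<cdot> swap C X Y)) \<cdot> assoc C X X Y \<cdot> (copy C X \<otimes> Ident C Y) \<cdot> \<langle>?i, h\<rangle> \<cdot> p"
    if h: "h \<in> hom C X Y" for h
  proof -
    have [simp]: "h \<in> Arr C" "Dom C h = X" "Cod C h = Y" "X \<in> Obj C" "Y \<in> Obj C" "Z \<in> Obj C"
      "k \<in> Arr C" "Dom C k = X" "Cod C k = Z" "p \<in> Arr C" "Dom C p = \<I>" "Cod C p = X"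
      using h k p by (auto simp: hom_iff)
    have "assoc C X X Y \<cdot> (copy C X \<otimes> Ident C Y) \<cdot> \<langle>?i, h\<rangle> = \<langle>?i, \<langle>?i, h\<rangle>\<rangle>"
      using assoc_pairing[of ?i ?i h] by (simp add: tensor_pairing copy_eq_pairing)
    moreover have "((Ident C Y \<otimes> k) \<cdot> swap C X Y) \<cdot> \<langle>?i, h\<rangle> = \<langle>h, k\<rangle>"
      using swap_pairing[of ?i h] by (simp add: comp_assoc tensor_pairing)
    ultimately have "(?i \<otimes> ((Ident C Y \<otimes> k) \<cdot> swap C X Y)) \<cdot> (assoc C X X Y \<cdot> (copy C X \<otimes> Ident C Y) \<cdot> \<langle>?i, h\<rangle>)
        = \<langle>?i, \<langle>h, k\<rangle>\<rangle>"
      by (simp add: tensor_pairing)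
    hence "\<langle>?i, \<langle>h, k\<rangle>\<rangle> \<cdot> p
      = ((?i \<otimes> ((Ident C Y \<otimes> k) \<cdot> swap C X Y)) \<cdot> (assoc C X X Y \<cdot> (copy C X \<otimes> Ident C Y) \<cdot> \<langle>?i, h\<rangle>)) \<cdot> p"
      by simp
    thus ?thesis by (simp add: comp_assoc)
  qed
  have "f \<in> hom C X Y" "g \<in> hom C X Y" using as_rel_hom[OF fg] by auto
  thus ?thesis using k eq by (simp add: as_rel_def * pairing_hom)
qed

lemma as_rel_pairing:
  assumes f: "(f, f') \<in> as_rel C X Y p" and g: "(g, g') \<in> as_rel C X Z p" and p: "p \<in> hom C \<I> X"
  shows "(\<langle>f, g\<rangle>, \<langle>f', g'\<rangle>) \<in> as_rel C X (Y \<odot> Z) p"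
proof -
  have h: "f' \<in> hom C X Y" "g \<in> hom C X Z" "g' \<in> hom C X Z" using as_rel_hom[OF f] as_rel_hom[OF g] by auto
  have "swap C Z Y \<in> hom C (Z \<odot> Y) (Y \<odot> Z)" using h by (simp add: hom_iff)
  from as_rel_comp_left[OF as_rel_pairing_left[OF g p h(1)] p this]
  have "(\<langle>f', g\<rangle>, \<langle>f', g'\<rangle>) \<in> as_rel C X (Y \<odot> Z) p"
    using swap_pairing[of g f'] swap_pairing[of g' f'] h by (simp add: hom_iff)
  with as_rel_pairing_left[OF f p h(2)] show ?thesis by (rule as_rel_trans)
qed

lemma as_deterministic_iff:
  "as_deterministic C X Y p f \<longleftrightarrow> f \<in> hom C X Y \<and> (copy C Y \<cdot> f, \<langle>f, f\<rangle>) \<in> as_rel C X (Y \<odot> Y) p"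
  by (auto simp: as_deterministic_def pairing_def hom_def)

lemma deterministic_as_deterministic:
  "\<lbrakk>deterministic f; f \<in> hom C X Y\<rbrakk> \<Longrightarrow> as_deterministic C X Y p f"
  by (auto simp: as_deterministic_iff deterministic_def hom_iff intro!: as_rel_refl)

lemma as_deterministic_Ident: "X \<in> Obj C \<Longrightarrow> as_deterministic C X X p (Ident C X)"
  by (rule deterministic_as_deterministic) (simp_all add: deterministic_def hom_iff pairing_def)

lemma as_deterministic_cong:
  assumes f: "as_deterministic C X Y p f" and fg: "(f, g) \<in> as_rel C X Y p" and p: "p \<in> hom C \<I> X"
  shows "as_deterministic C X Y p g"
proof -
  have c: "copy C Y \<in> hom C Y (Y \<odot> Y)" using as_rel_hom[OF fg] by (simp add: hom_iff)
  have "(copy C Y \<cdot> g, \<langle>f, f\<rangle>) \<in> as_rel C X (Y \<odot> Y) p"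
    using as_rel_sym[OF as_rel_comp_left[OF fg p c]] f as_rel_trans by (auto simp: as_deterministic_iff)
  from as_rel_trans[OF this as_rel_pairing[OF fg fg p]] show ?thesis
    using as_rel_hom[OF fg] by (simp add: as_deterministic_iff)
qed

text \<open>
  Computing two quantities from one sample of \<open>f\<close>, or each from its own, makes no difference to the
  law when \<open>f\<close> is almost surely deterministic.
\<close>

lemma pairing_comp_as_deterministic:
  assumes f: "as_deterministic C X Y p f" and p: "p \<in> hom C \<I> X"
    and g: "g \<in> hom C Y Z" and h: "h \<in> hom C Y W"
  shows "\<langle>g, h\<rangle> \<cdot> f \<cdot> p = \<langle>g \<cdot> f, h \<cdot> f\<rangle> \<cdot> p"
proof -
  have t [simp]: "f \<in> Arr C" "Dom C f = X" "Cod C f = Y" "Y \<in> Obj C" "X \<in> Obj C" "Z \<in> Obj C" "W \<in> Obj C"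
    "p \<in> Arr C" "Dom C p = \<I>" "Cod C p = X" "g \<in> Arr C" "Dom C g = Y" "Cod C g = Z"
    "h \<in> Arr C" "Dom C h = Y" "Cod C h = W"
    using assms by (auto simp: hom_iff as_deterministic_def)
  have "(copy C Y \<cdot> f) \<cdot> p = \<langle>f, f\<rangle> \<cdot> p"
    using f p by (intro as_rel_state) (auto simp: as_deterministic_iff)
  hence "(g \<otimes> h) \<cdot> ((copy C Y \<cdot> f) \<cdot> p) = (g \<otimes> h) \<cdot> (\<langle>f, f\<rangle> \<cdot> p)"
    by simp
  thus ?thesis
    by (simp add: comp_assoc[symmetric] tensor_pairing) (simp add: pairing_def comp_assoc)
qed

text \<open>
  Maps of sample spaces are epimorphisms up to almost sure equality: since \<open>e\<close> is almost surely
  deterministic, the joint law of \<open>f\<close> with the sample point \<open>e\<close> is the joint law of \<open>f \<cdot> e\<close> and \<open>e\<close>.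
\<close>

lemma as_rel_cancel:
  assumes e: "as_deterministic C X' X q e" and q: "q \<in> hom C \<I> X'"
    and f: "f \<in> hom C X Y" and g: "g \<in> hom C X Y"
    and fg: "(f \<cdot> e, g \<cdot> e) \<in> as_rel C X' Y q"
  shows "(f, g) \<in> as_rel C X Y (e \<cdot> q)"
proof -
  have i: "Ident C X \<in> hom C X X" and e': "e \<in> hom C X' X"
    using f e by (auto simp: hom_iff as_deterministic_def)
  have "\<langle>Ident C X, f\<rangle> \<cdot> e \<cdot> q = \<langle>e, f \<cdot> e\<rangle> \<cdot> q"
    using pairing_comp_as_deterministic[OF e q i f] e' by (simp add: hom_iff)
  also have "\<dots> = \<langle>e, g \<cdot> e\<rangle> \<cdot> q"
    by (rule as_rel_joint[OF fg q e'])
  also have "\<dots> = \<langle>Ident C X, g\<rangle> \<cdot> e \<cdot> q"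
    using pairing_comp_as_deterministic[OF e q i g] e' by (simp add: hom_iff)
  finally show ?thesis using f g by (simp add: as_rel_def)
qed

lemma as_class_eq_iff:
  assumes "f \<in> hom C X Y" "g \<in> hom C X Y"
  shows "as_class C X Y p f = as_class C X Y p g \<longleftrightarrow> (f, g) \<in> as_rel C X Y p"
  using assms unfolding as_class_def
  by (auto intro: as_rel_trans as_rel_sym dest: as_rel_refl)

end


section \<open>Bayesian inverses and descent\<close>

locale markov_category_with_conditionals = markov_category C
  for C :: "('o, 'a, 'z) markov_data_scheme" (structure) +
  assumes conditionals: "has_conditionals C"
begin

text \<open>
  A conditional of the state \<open>\<langle>f, id\<rangle> \<cdot> q\<close> on \<open>Y \<otimes> X\<close> given \<open>Y\<close> is an arrow \<open>k : Y \<otimes> I \<rightarrow> X\<close>, because a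
  state has the unit as its domain. Filling the unit with a deleted copy of \<open>Y\<close> turns \<open>k\<close> into the
  required \<open>s : Y \<rightarrow> X\<close>.
\<close>

lemma bayesian_inverse:
  assumes q: "q \<in> hom C \<I> X" and f: "f \<in> hom C X Y"
  obtains s where "s \<in> hom C Y X" "\<langle>Ident C X, f\<rangle> \<cdot> q = \<langle>s, Ident C Y\<rangle> \<cdot> f \<cdot> q"
proof -
  have t [simp]: "f \<in> Arr C" "Dom C f = X" "Cod C f = Y" "X \<in> Obj C" "Y \<in> Obj C"
    "q \<in> Arr C" "Dom C q = \<I>" "Cod C q = X"
    using assms by (auto simp: hom_iff)
  let ?i = "Ident C Y" and ?phi = "\<langle>f, Ident C X\<rangle> \<cdot> q" and ?p = "f \<cdot> q"
  have "?phi \<in> hom C \<I> (Y \<odot> X)" by (simp add: hom_iff)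
  moreover have "proj1 C Y X \<cdot> ?phi = ?p"
    by (simp add: comp_assoc[symmetric] proj_pairing)
  ultimately obtain k where k: "k \<in> hom C (Y \<odot> \<I>) X"
    and phi: "?phi = (?i \<otimes> k) \<cdot> assoc C Y Y \<I> \<cdot> (copy C Y \<otimes> Ident C \<I>) \<cdot> (?p \<otimes> Ident C \<I>) \<cdot> copy C \<I>"
    using conditionals unfolding has_conditionals_def by (metis t(4,5) unit_Obj)
  have k' [simp]: "k \<in> Arr C" "Dom C k = Y \<odot> \<I>" "Cod C k = X" using k by (auto simp: hom_iff)
  let ?u = "\<langle>?i, del C Y\<rangle>"
  \<comment> \<open>The left-hand side comes from the definition of a conditional, where the unit is paired with \<open>?p\<close>.\<close>
  have state: "(?p \<otimes> Ident C \<I>) \<cdot> copy C \<I> = ?u \<cdot> ?p"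
  proof (rule iso_cancel_left[where u = "runit C Y"])
    have "runit C Y \<cdot> (?p \<otimes> Ident C \<I>) \<cdot> copy C \<I> = (runit C Y \<cdot> (?p \<otimes> Ident C \<I>)) \<cdot> copy C \<I>"
      by (simp add: comp_assoc)
    also have "\<dots> = ?p \<cdot> (lunit C \<I> \<cdot> copy C \<I>)"
      by (simp add: runit_nat comp_assoc runit_unit)
    also have "\<dots> = (runit C Y \<cdot> ?u) \<cdot> ?p"
      by (simp add: lunit_copy_unit pairing_def copy_counit_right)
    finally show "runit C Y \<cdot> (?p \<otimes> Ident C \<I>) \<cdot> copy C \<I> = runit C Y \<cdot> ?u \<cdot> ?p"
      by (simp add: comp_assoc)
  qed (simp_all add: runit_iso)
  have "?phi = ((?i \<otimes> k) \<cdot> (assoc C Y Y \<I> \<cdot> ((copy C Y \<otimes> Ident C \<I>) \<cdot> ?u))) \<cdot> ?p"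
    unfolding phi state by (simp add: comp_assoc)
  also have "(copy C Y \<otimes> Ident C \<I>) \<cdot> ?u = \<langle>\<langle>?i, ?i\<rangle>, del C Y\<rangle>"
    by (simp add: tensor_pairing copy_eq_pairing)
  also have "assoc C Y Y \<I> \<cdot> \<dots> = \<langle>?i, ?u\<rangle>"
    using assoc_pairing[of ?i ?i "del C Y"] by simp
  also have "(?i \<otimes> k) \<cdot> \<dots> = \<langle>?i, k \<cdot> ?u\<rangle>"
    by (simp add: tensor_pairing)
  finally have eq: "?phi = \<langle>?i, k \<cdot> ?u\<rangle> \<cdot> ?p" .
  have "\<langle>Ident C X, f\<rangle> \<cdot> q = swap C Y X \<cdot> ?phi"
    using swap_pairing[of f "Ident C X"] by (simp add: comp_assoc[symmetric])
  also have "\<dots> = \<langle>k \<cdot> ?u, ?i\<rangle> \<cdot> ?p"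
    unfolding eq using swap_pairing[of ?i "k \<cdot> ?u"] by (simp add: comp_assoc[symmetric])
  finally show thesis by (rule that[rotated]) (simp add: hom_iff)
qed

text \<open>
  The sample point in \<open>X\<close> can be drawn again from the value of \<open>f\<close> by a Bayesian inverse \<open>s\<close>, so the
  joint law of \<open>g \<cdot> f\<close> with it is the law of \<open>\<langle>s, g\<rangle>\<close> under \<open>f \<cdot> p\<close>, where \<open>g\<close> and \<open>h\<close> are
  interchangeable.
\<close>

lemma as_rel_comp_right:
  assumes p: "p \<in> hom C \<I> X" and f: "f \<in> hom C X Y"
    and gh: "(g, h) \<in> as_rel C Y Z (f \<cdot> p)"
  shows "(g \<cdot> f, h \<cdot> f) \<in> as_rel C X Z p"
proof -
  obtain s where s: "s \<in> hom C Y X" and b: "\<langle>Ident C X, f\<rangle> \<cdot> p = \<langle>s, Ident C Y\<rangle> \<cdot> f \<cdot> p"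
    by (rule bayesian_inverse[OF p f])
  have t: "f \<in> Arr C" "Dom C f = X" "Cod C f = Y" "X \<in> Obj C" "Y \<in> Obj C"
    "p \<in> Arr C" "Dom C p = \<I>" "Cod C p = X" "s \<in> Arr C" "Dom C s = Y" "Cod C s = X"
    using p f s by (auto simp: hom_iff)
  have *: "\<langle>Ident C X, k \<cdot> f\<rangle> \<cdot> p = \<langle>s, k\<rangle> \<cdot> f \<cdot> p" if k: "k \<in> hom C Y Z" for k
  proof -
    have k': "k \<in> Arr C" "Dom C k = Y" "Cod C k = Z" "Z \<in> Obj C" using k by (auto simp: hom_iff)
    have "\<langle>Ident C X, k \<cdot> f\<rangle> \<cdot> p = (Ident C X \<otimes> k) \<cdot> \<langle>Ident C X, f\<rangle> \<cdot> p"
      using t k' by (simp add: comp_assoc[symmetric] tensor_pairing)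
    also have "\<dots> = ((Ident C X \<otimes> k) \<cdot> \<langle>s, Ident C Y\<rangle>) \<cdot> f \<cdot> p"
      unfolding b using t k' by (simp add: comp_assoc)
    finally show ?thesis using t k' by (simp add: tensor_pairing)
  qed
  have "f \<cdot> p \<in> hom C \<I> Y" using t by (simp add: hom_iff)
  with as_rel_joint[OF gh _ s] have "\<langle>s, g\<rangle> \<cdot> f \<cdot> p = \<langle>s, h\<rangle> \<cdot> f \<cdot> p" by simp
  with as_rel_hom[OF gh] f show ?thesis by (simp add: as_rel_def * Comp_hom)
qed

lemma as_deterministic_comp:
  assumes p: "p \<in> hom C \<I> X" and f: "as_deterministic C X Y p f"
    and g: "as_deterministic C Y Z (f \<cdot> p) g"
  shows "as_deterministic C X Z p (g \<cdot> f)"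
proof -
  have f': "f \<in> hom C X Y" and g': "g \<in> hom C Y Z"
    using f g by (auto simp: as_deterministic_def)
  have t: "f \<in> Arr C" "Dom C f = X" "Cod C f = Y" "X \<in> Obj C" "Y \<in> Obj C" "Z \<in> Obj C"
    "g \<in> Arr C" "Dom C g = Y" "Cod C g = Z"
    using f' g' by (auto simp: hom_iff)
  have "(copy C Z \<cdot> g, \<langle>g, g\<rangle>) \<in> as_rel C Y (Z \<odot> Z) (f \<cdot> p)"
    using g by (simp add: as_deterministic_iff)
  from as_rel_comp_right[OF p f' this]
  have 1: "(copy C Z \<cdot> g \<cdot> f, \<langle>g, g\<rangle> \<cdot> f) \<in> as_rel C X (Z \<odot> Z) p"
    using t by (simp add: comp_assoc)
  have "(copy C Y \<cdot> f, \<langle>f, f\<rangle>) \<in> as_rel C X (Y \<odot> Y) p" "g \<otimes> g \<in> hom C (Y \<odot> Y) (Z \<odot> Z)"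
    using f t by (simp_all add: as_deterministic_iff hom_iff)
  from as_rel_comp_left[OF this(1) p this(2)]
  have "(\<langle>g, g\<rangle> \<cdot> f, \<langle>g \<cdot> f, g \<cdot> f\<rangle>) \<in> as_rel C X (Z \<odot> Z) p"
    using t by (simp add: tensor_pairing) (simp add: pairing_def comp_assoc)
  with 1 show ?thesis using f' g' as_rel_trans by (auto simp: as_deterministic_iff Comp_hom)
qed

text \<open>
  The joint law of the sample point with \<open>(f, g)\<close> is obtained from the law of \<open>(f, g)\<close> by a Bayesian
  inverse. The latter law consists of two copies of \<open>h\<close>, so discarding one copy or the other leaves
  the same joint law.
\<close>

lemma as_rel_of_diagonal:
  assumes p: "p \<in> hom C \<I> X" and f: "f \<in> hom C X Y" and g: "g \<in> hom C X Y" and h: "h \<in> hom C \<I> Y"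
    and diag: "\<langle>f, g\<rangle> \<cdot> p = copy C Y \<cdot> h"
  shows "(f, g) \<in> as_rel C X Y p"
proof -
  have t: "f \<in> Arr C" "Dom C f = X" "Cod C f = Y" "X \<in> Obj C" "Y \<in> Obj C"
    "g \<in> Arr C" "Dom C g = X" "Cod C g = Y" "h \<in> Arr C" "Dom C h = \<I>" "Cod C h = Y"
    "p \<in> Arr C" "Dom C p = \<I>" "Cod C p = X"
    using p f g h by (auto simp: hom_iff)
  let ?i = "Ident C X"
  obtain s where s: "s \<in> hom C (Y \<odot> Y) X"
    and b: "\<langle>?i, \<langle>f, g\<rangle>\<rangle> \<cdot> p = \<langle>s, Ident C (Y \<odot> Y)\<rangle> \<cdot> \<langle>f, g\<rangle> \<cdot> p"
    by (rule bayesian_inverse[OF p pairing_hom[OF f g]])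
  have s': "s \<in> Arr C" "Dom C s = Y \<odot> Y" "Cod C s = X" using s by (auto simp: hom_iff)
  have "\<langle>?i, \<langle>f, g\<rangle>\<rangle> \<cdot> p = (\<langle>s, Ident C (Y \<odot> Y)\<rangle> \<cdot> copy C Y) \<cdot> h"
    unfolding b diag using t s' by (simp add: comp_assoc)
  also have "\<dots> = \<langle>s \<cdot> copy C Y, copy C Y\<rangle> \<cdot> h"
    using t s' pairing_comp_deterministic[OF deterministic_copy, of Y s "Ident C (Y \<odot> Y)"] by simp
  finally have eq: "\<langle>?i, \<langle>f, g\<rangle>\<rangle> \<cdot> p = \<langle>s \<cdot> copy C Y, copy C Y\<rangle> \<cdot> h" .
  have c: "proj1 C Y Y \<cdot> copy C Y = Ident C Y" "proj2 Y Y \<cdot> copy C Y = Ident C Y"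
    using t by (simp_all add: copy_eq_pairing proj_pairing)
  have "\<langle>?i, f\<rangle> \<cdot> p = (?i \<otimes> proj1 C Y Y) \<cdot> \<langle>?i, \<langle>f, g\<rangle>\<rangle> \<cdot> p"
    using t by (simp add: comp_assoc[symmetric] tensor_pairing proj_pairing)
  also have "\<dots> = \<langle>s \<cdot> copy C Y, Ident C Y\<rangle> \<cdot> h"
    unfolding eq using t s' c by (simp add: comp_assoc[symmetric] tensor_pairing)
  also have "\<dots> = (?i \<otimes> proj2 Y Y) \<cdot> \<langle>?i, \<langle>f, g\<rangle>\<rangle> \<cdot> p"
    unfolding eq using t s' c by (simp add: comp_assoc[symmetric] tensor_pairing)
  also have "\<dots> = \<langle>?i, g\<rangle> \<cdot> p"
    using t by (simp add: comp_assoc[symmetric] tensor_pairing proj_pairing)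
  finally show ?thesis using f g by (simp add: as_rel_def)
qed

text \<open>
  Determinism of \<open>x\<close> is an almost sure equality of arrows out of \<open>X\<close>, so it suffices to verify it after
  composition with \<open>e\<close>, where it becomes the determinism of \<open>y\<close>.
\<close>

lemma as_deterministic_descend:
  assumes e: "as_deterministic C X' X q e" and q: "q \<in> hom C \<I> X'"
    and y: "as_deterministic C X' V q y" and x: "x \<in> hom C X V"
    and xy: "(x \<cdot> e, y) \<in> as_rel C X' V q"
  shows "as_deterministic C X V (e \<cdot> q) x"
proof -
  have t: "e \<in> Arr C" "Dom C e = X'" "Cod C e = X" "X' \<in> Obj C" "X \<in> Obj C" "V \<in> Obj C"
    "x \<in> Arr C" "Dom C x = X" "Cod C x = V"
    using e x by (auto simp: hom_iff as_deterministic_def)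
  have "as_deterministic C X' V q (x \<cdot> e)"
    by (rule as_deterministic_cong[OF y as_rel_sym[OF xy] q])
  hence 1: "((copy C V \<cdot> x) \<cdot> e, \<langle>x \<cdot> e, x \<cdot> e\<rangle>) \<in> as_rel C X' (V \<odot> V) q"
    using t by (simp add: as_deterministic_iff comp_assoc)
  have "(copy C X \<cdot> e, \<langle>e, e\<rangle>) \<in> as_rel C X' (X \<odot> X) q" "x \<otimes> x \<in> hom C (X \<odot> X) (V \<odot> V)"
    using e t by (simp_all add: as_deterministic_iff hom_iff)
  from as_rel_comp_left[OF this(1) q this(2)]
  have "(\<langle>x, x\<rangle> \<cdot> e, \<langle>x \<cdot> e, x \<cdot> e\<rangle>) \<in> as_rel C X' (V \<odot> V) q"
    using t by (simp add: tensor_pairing) (simp add: pairing_def comp_assoc)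
  from as_rel_trans[OF 1 as_rel_sym[OF this]]
  have "(copy C V \<cdot> x, \<langle>x, x\<rangle>) \<in> as_rel C X (V \<odot> V) (e \<cdot> q)"
    by (intro as_rel_cancel[OF e q]) (use t in \<open>simp_all add: hom_iff\<close>)
  thus ?thesis using x by (simp add: as_deterministic_iff)
qed

text \<open>
  The witness is \<open>y \<cdot> s\<close> with \<open>s\<close> a Bayesian inverse of \<open>e\<close>, and the invariance is used for a single
  parallel pair: the two projections of \<open>X' \<otimes> X'\<close> under the state of two conditionally independent
  points of a random fibre.
\<close>

lemma descent:
  assumes e: "as_deterministic C X' X q e" and q: "q \<in> hom C \<I> X'"
    and y: "as_deterministic C X' V q y"
    and inv: "\<And>Z r a b. \<lbrakk>Z \<in> Obj C; r \<in> hom C \<I> Z; as_deterministic C Z X' r a; as_deterministic C Z X' r b;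
                a \<cdot> r = q; b \<cdot> r = q; (e \<cdot> a, e \<cdot> b) \<in> as_rel C Z X r\<rbrakk>
              \<Longrightarrow> (y \<cdot> a, y \<cdot> b) \<in> as_rel C Z V r"
  obtains x where "as_deterministic C X V (e \<cdot> q) x" "(x \<cdot> e, y) \<in> as_rel C X' V q"
proof -
  have e': "e \<in> hom C X' X" and y': "y \<in> hom C X' V"
    using e y by (auto simp: as_deterministic_def)
  obtain s where s: "s \<in> hom C X X'"
    and b: "\<langle>Ident C X', e\<rangle> \<cdot> q = \<langle>s, Ident C X\<rangle> \<cdot> e \<cdot> q"
    by (rule bayesian_inverse[OF q e'])
  let ?p = "e \<cdot> q" and ?Z = "X' \<odot> X'"
  have t [simp]: "e \<in> Arr C" "Dom C e = X'" "Cod C e = X" "X' \<in> Obj C" "X \<in> Obj C" "V \<in> Obj C"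
    "y \<in> Arr C" "Dom C y = X'" "Cod C y = V" "q \<in> Arr C" "Dom C q = \<I>" "Cod C q = X'"
    "s \<in> Arr C" "Dom C s = X" "Cod C s = X'"
    using e' y' q s by (auto simp: hom_iff)
  \<comment> \<open>A variable computed from the random point of the fibre can be computed from the point of \<open>X'\<close> itself.\<close>
  have push: "\<langle>f \<cdot> s, g\<rangle> \<cdot> ?p = \<langle>f, g \<cdot> e\<rangle> \<cdot> q"
    if f: "f \<in> hom C X' A" and g: "g \<in> hom C X B" for f g A B
  proof -
    have u: "f \<in> Arr C" "Dom C f = X'" "Cod C f = A" "A \<in> Obj C"
      "g \<in> Arr C" "Dom C g = X" "Cod C g = B" "B \<in> Obj C"
      using f g by (auto simp: hom_iff)
    have "\<langle>f \<cdot> s, g\<rangle> \<cdot> ?p = (f \<otimes> g) \<cdot> \<langle>s, Ident C X\<rangle> \<cdot> ?p"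
      using u by (simp add: comp_assoc[symmetric] tensor_pairing)
    also have "\<dots> = \<langle>f, g \<cdot> e\<rangle> \<cdot> q"
      unfolding b[symmetric] using u by (simp add: comp_assoc[symmetric] tensor_pairing)
    finally show ?thesis .
  qed
  have i: "Ident C X \<in> hom C X X" and i': "Ident C X' \<in> hom C X' X'" by (simp_all add: hom_iff)
  have sp: "s \<cdot> ?p = q"
  proof -
    have "s \<cdot> ?p = proj1 C X' X \<cdot> \<langle>s, Ident C X\<rangle> \<cdot> ?p"
      using proj_pairing(1)[of s "Ident C X" X' X] by (simp add: comp_assoc[symmetric])
    also have "\<dots> = proj1 C X' X \<cdot> \<langle>Ident C X', e\<rangle> \<cdot> q" by (simp only: b)
    also have "\<dots> = q"
      using proj_pairing(1)[of "Ident C X'" e X' X] by (simp add: comp_assoc[symmetric])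
    finally show ?thesis .
  qed
  \<comment> \<open>A random point of the fibre over a point lies over that point.\<close>
  have es: "(e \<cdot> s, Ident C X) \<in> as_rel C X X ?p"
  proof -
    have "\<langle>Ident C X, e \<cdot> s\<rangle> \<cdot> ?p = swap C X X \<cdot> \<langle>e \<cdot> s, Ident C X\<rangle> \<cdot> ?p"
      using swap_pairing[of "e \<cdot> s" "Ident C X"] by (simp add: comp_assoc[symmetric])
    also have "\<langle>e \<cdot> s, Ident C X\<rangle> \<cdot> ?p = \<langle>e, e\<rangle> \<cdot> q"
      using push[OF e' i] by simp
    also have "\<dots> = copy C X \<cdot> e \<cdot> q"
      using pairing_comp_as_deterministic[OF e q i i] by (simp add: copy_eq_pairing)
    also have "swap C X X \<cdot> \<dots> = copy C X \<cdot> e \<cdot> q"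
      by (simp add: comp_assoc[symmetric] copy_commute)
    finally show ?thesis by (simp add: as_rel_def hom_iff copy_eq_pairing)
  qed
  define r where "r = \<langle>s, s\<rangle> \<cdot> ?p"
  let ?a = "proj1 C X' X'" and ?b = "proj2 X' X'"
  have [simp]: "r \<in> Arr C" "Dom C r = \<I>" "Cod C r = ?Z" by (simp_all add: r_def)
  have ab: "as_deterministic C ?Z X' r ?a" "as_deterministic C ?Z X' r ?b"
    by (auto intro!: deterministic_as_deterministic deterministic_proj1 deterministic_proj2 simp: hom_iff)
  have abr: "?a \<cdot> r = q" "?b \<cdot> r = q"
    by (simp_all add: r_def comp_assoc[symmetric] proj_pairing) (simp_all add: comp_assoc sp)
  \<comment> \<open>Under \<open>r\<close> the two projections are conditionally independent draws from the same fibre.\<close>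
  have joint: "\<langle>f \<cdot> ?a, g \<cdot> ?b\<rangle> \<cdot> r = \<langle>f \<cdot> s, g \<cdot> s\<rangle> \<cdot> ?p"
    if "f \<in> hom C X' A" "g \<in> hom C X' B" for f g A B
  proof -
    have u: "f \<in> Arr C" "Dom C f = X'" "Cod C f = A" "A \<in> Obj C"
      "g \<in> Arr C" "Dom C g = X'" "Cod C g = B" "B \<in> Obj C"
      using that by (auto simp: hom_iff)
    have "\<langle>f \<cdot> ?a, g \<cdot> ?b\<rangle> \<cdot> r = (f \<otimes> g) \<cdot> \<langle>?a, ?b\<rangle> \<cdot> r"
      using u by (simp add: comp_assoc[symmetric] tensor_pairing)
    also have "\<dots> = \<langle>f \<cdot> s, g \<cdot> s\<rangle> \<cdot> ?p"
      using u by (simp add: pairing_proj1_proj2 r_def comp_assoc[symmetric] tensor_pairing)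
    finally show ?thesis .
  qed
  have p: "?p \<in> hom C \<I> X" and r: "r \<in> hom C \<I> ?Z" by (simp_all add: hom_iff)
  have "\<langle>e \<cdot> ?a, e \<cdot> ?b\<rangle> \<cdot> r = \<langle>e \<cdot> s, e \<cdot> s\<rangle> \<cdot> ?p" by (rule joint[OF e' e'])
  also have "\<dots> = copy C X \<cdot> ?p"
    using as_rel_state[OF as_rel_pairing[OF es es p] p] by (simp add: copy_eq_pairing)
  finally have "(e \<cdot> ?a, e \<cdot> ?b) \<in> as_rel C ?Z X r"
    by (intro as_rel_of_diagonal[OF r _ _ p]) (simp_all add: hom_iff)
  from inv[OF _ r ab abr this] have yab: "(y \<cdot> ?a, y \<cdot> ?b) \<in> as_rel C ?Z V r" by simp
  \<comment> \<open>In the joint law of the first point and the value of \<open>y\<close> there, evaluate \<open>y\<close> at the second point instead.\<close>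
  have "\<langle>Ident C X', y\<rangle> \<cdot> q = (\<langle>Ident C X', y\<rangle> \<cdot> ?a) \<cdot> r"
    by (simp add: comp_assoc abr)
  also have "\<dots> = \<langle>?a, y \<cdot> ?a\<rangle> \<cdot> r"
    using pairing_comp_deterministic[OF deterministic_proj1, of X' X' "Ident C X'" y] by simp
  also have "\<dots> = \<langle>?a, y \<cdot> ?b\<rangle> \<cdot> r"
    by (rule as_rel_joint[OF yab r, where Z = X']) (simp add: hom_iff)
  also have "\<dots> = \<langle>s, y \<cdot> s\<rangle> \<cdot> ?p"
    using joint[OF i' y'] by simp
  also have "\<dots> = \<langle>Ident C X', (y \<cdot> s) \<cdot> e\<rangle> \<cdot> q"
    using push[OF i', of "y \<cdot> s" V] by (simp add: hom_iff)
  finally have xy: "((y \<cdot> s) \<cdot> e, y) \<in> as_rel C X' V q"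
    by (simp add: as_rel_def hom_iff)
  have x: "y \<cdot> s \<in> hom C X V" by (simp add: hom_iff)
  show thesis
    by (rule that[OF as_deterministic_descend[OF e q y x xy] xy])
qed


section \<open>Sheaves on sample spaces\<close>

text \<open>
  The union in the definition of the composite is one over equal classes. One may change \<open>g\<close> because \<open>f \<cdot> p\<close> is
  the state for which its class is taken.
\<close>

lemma class_comp_as_class:
  assumes p: "p \<in> hom C \<I> X" and f: "f \<in> hom C X Y" and g: "g \<in> hom C Y Z"
  shows "class_comp C X Z p (as_class C Y Z (f \<cdot> p) g) (as_class C X Y p f) = as_class C X Z p (g \<cdot> f)"
proof -
  have "as_class C X Z p (g' \<cdot> f') = as_class C X Z p (g \<cdot> f)"
    if g': "g' \<in> as_class C Y Z (f \<cdot> p) g" and f': "f' \<in> as_class C X Y p f" for g' f'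
  proof -
    have g': "(g, g') \<in> as_rel C Y Z (f \<cdot> p)" and f': "(f, f') \<in> as_rel C X Y p"
      using g' f' by (auto simp: as_class_def)
    have "g' \<in> hom C Y Z" "f' \<in> hom C X Y" using as_rel_hom[OF g'] as_rel_hom[OF f'] by auto
    moreover have "(g \<cdot> f, g' \<cdot> f') \<in> as_rel C X Z p"
      by (rule as_rel_trans[OF as_rel_comp_right[OF p f g'] as_rel_comp_left[OF f' p \<open>g' \<in> hom C Y Z\<close>]])
    ultimately show ?thesis using f g by (subst as_class_eq_iff) (auto intro: as_rel_sym Comp_hom)
  qed
  moreover have "g \<in> as_class C Y Z (f \<cdot> p) g" "f \<in> as_class C X Y p f"
    using f g by (auto simp: as_class_def intro: as_rel_refl)
  ultimately show ?thesis unfolding class_comp_def by blast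
qed

abbreviation sample :: "'o \<Rightarrow> 'a \<Rightarrow> 'o \<Rightarrow> 'a \<Rightarrow> ('o, 'a) sample_map" where
  "sample X p Y f \<equiv> ((X, p), (Y, f \<cdot> p), as_class C X Y p f)"

lemma sample_cat_Obj: "(X, p) \<in> Obj (sample_cat C) \<longleftrightarrow> p \<in> hom C \<I> X"
  by (auto simp: sample_cat_def hom_iff)

lemma sample_cat_simps [simp]:
  "Dom (sample_cat C) (A, B, F) = A" "Cod (sample_cat C) (A, B, F) = B"
  "Ident (sample_cat C) (X, p) = ((X, p), (X, p), as_class C X X p (Ident C X))"
  "(B', (Z, r), G) \<cdot>\<^bsub>sample_cat C\<^esub> ((X, p), B, F) = ((X, p), (Z, r), class_comp C X Z p G F)"
  by (simp_all add: sample_cat_def)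

lemma sample_Arr:
  assumes "p \<in> hom C \<I> X" "as_deterministic C X Y p f"
  shows "sample X p Y f \<in> Arr (sample_cat C)"
proof -
  have "f \<in> hom C X Y" using assms by (simp add: as_deterministic_def)
  hence "X \<in> Obj C" "Y \<in> Obj C" "f \<cdot> p \<in> hom C \<I> Y" using assms by (auto simp: hom_iff)
  thus ?thesis using assms by (auto simp: sample_cat_def)
qed

lemma sample_ArrE:
  assumes "F \<in> Arr (sample_cat C)"
  obtains X p Y f where "F = sample X p Y f" "p \<in> hom C \<I> X" "as_deterministic C X Y p f" "f \<in> hom C X Y"
  using assms by (auto simp: sample_cat_def as_deterministic_def)

lemma sample_homE:
  assumes "F \<in> hom (sample_cat C) A B"
  obtains X p Y f where "A = (X, p)" "B = (Y, f \<cdot> p)" "F = sample X p Y f"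
    "p \<in> hom C \<I> X" "as_deterministic C X Y p f" "f \<in> hom C X Y"
proof -
  have "F \<in> Arr (sample_cat C)" and AB: "A = Dom (sample_cat C) F" "B = Cod (sample_cat C) F"
    using assms by (auto simp: hom_def)
  from this(1) obtain X p Y f where F: "F = sample X p Y f" "p \<in> hom C \<I> X"
    "as_deterministic C X Y p f" "f \<in> hom C X Y" by (rule sample_ArrE)
  show thesis by (rule that[of X p Y f]) (use F AB in simp_all)
qed

lemma sample_hom:
  "\<lbrakk>p \<in> hom C \<I> X; as_deterministic C X Y p f; q = f \<cdot> p\<rbrakk>
     \<Longrightarrow> ((X, p), (Y, q), as_class C X Y p f) \<in> hom (sample_cat C) (X, p) (Y, q)"
  using sample_Arr by (auto simp: hom_def)

lemma sample_comp:
  assumes "p \<in> hom C \<I> X" "f \<in> hom C X Y" "g \<in> hom C Y Z"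
  shows "sample Y (f \<cdot> p) Z g \<cdot>\<^bsub>sample_cat C\<^esub> sample X p Y f = sample X p Z (g \<cdot> f)"
  using assms by (simp add: class_comp_as_class Comp_assoc)

lemma category_sample_cat: "category (sample_cat C)"
proof
  fix F assume "F \<in> Arr (sample_cat C)"
  then obtain X p Y f where F: "F = sample X p Y f" "p \<in> hom C \<I> X" "f \<in> hom C X Y"
    by (rule sample_ArrE)
  thus "Dom (sample_cat C) F \<in> Obj (sample_cat C)" "Cod (sample_cat C) F \<in> Obj (sample_cat C)"
    by (simp_all add: sample_cat_Obj Comp_hom)
next
  fix A assume "A \<in> Obj (sample_cat C)"
  then obtain X p where A: "A = (X, p)" and p: "p \<in> hom C \<I> X"
    by (cases A) (auto simp: sample_cat_Obj)
  show "Ident (sample_cat C) A \<in> hom (sample_cat C) A A"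
    unfolding A sample_cat_simps
    by (rule sample_hom[OF p as_deterministic_Ident]) (use p in \<open>simp_all add: hom_iff\<close>)
next
  fix F G A B D assume "F \<in> hom (sample_cat C) A B" "G \<in> hom (sample_cat C) B D"
  then obtain X p Y f Z g where F: "A = (X, p)" "B = (Y, f \<cdot> p)" "F = sample X p Y f"
      "p \<in> hom C \<I> X" "as_deterministic C X Y p f" "f \<in> hom C X Y"
    and G: "D = (Z, g \<cdot> f \<cdot> p)" "G = sample Y (f \<cdot> p) Z g" "as_deterministic C Y Z (f \<cdot> p) g" "g \<in> hom C Y Z"
    by (auto elim!: sample_homE)
  show "G \<cdot>\<^bsub>sample_cat C\<^esub> F \<in> hom (sample_cat C) A D"
    unfolding F(3) G(2) sample_comp[OF F(4,6) G(4)] unfolding F(1) G(1)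
    using sample_hom[OF F(4) as_deterministic_comp[OF F(4,5) G(3)] refl] Comp_assoc[OF F(4,6) G(4)] by simp
next
  fix F A B assume "F \<in> hom (sample_cat C) A B"
  then obtain X p Y f where F: "A = (X, p)" "B = (Y, f \<cdot> p)" "F = sample X p Y f"
      "p \<in> hom C \<I> X" "f \<in> hom C X Y" by (rule sample_homE)
  have X: "X \<in> Obj C" "Y \<in> Obj C" using F by (auto simp: hom_iff)
  show "Ident (sample_cat C) B \<cdot>\<^bsub>sample_cat C\<^esub> F = F"
    unfolding F using class_comp_as_class[OF F(4,5) Ident_hom[OF X(2)]] F by (simp add: Comp_Ident_left)
  have "Ident C X \<cdot> p = p" using F by (simp add: Comp_Ident_left)
  thus "F \<cdot>\<^bsub>sample_cat C\<^esub> Ident (sample_cat C) A = F"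
    unfolding F using class_comp_as_class[OF F(4) Ident_hom[OF X(1)] F(5)] F by (simp add: Comp_Ident_right)
next
  fix F G H A B D E
  assume "F \<in> hom (sample_cat C) A B" "G \<in> hom (sample_cat C) B D" "H \<in> hom (sample_cat C) D E"
  then obtain X p Y f Z g W h where F: "F = sample X p Y f" "p \<in> hom C \<I> X" "f \<in> hom C X Y"
    and G: "G = sample Y (f \<cdot> p) Z g" "g \<in> hom C Y Z"
    and H: "H = sample Z (g \<cdot> f \<cdot> p) W h" "h \<in> hom C Z W"
    by (auto elim!: sample_homE)
  have fp: "f \<cdot> p \<in> hom C \<I> Y" and gf: "g \<cdot> f \<in> hom C X Z" and hg: "h \<cdot> g \<in> hom C Y W"
    using F G H by (auto intro: Comp_hom)
  show "(H \<cdot>\<^bsub>sample_cat C\<^esub> G) \<cdot>\<^bsub>sample_cat C\<^esub> F = H \<cdot>\<^bsub>sample_cat C\<^esub> (G \<cdot>\<^bsub>sample_cat C\<^esub> F)"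
    unfolding F(1) G(1) H(1) sample_comp[OF fp G(2) H(2)] sample_comp[OF F(2,3) hg] sample_comp[OF F(2,3) G(2)]
    using sample_comp[OF F(2) gf H(2)] Comp_assoc[OF F(2,3) G(2)] Comp_assoc[OF F(3) G(2) H(2)] by simp
qed

text \<open>
  Almost sure equality of \<open>e \<cdot> a\<close> and \<open>e \<cdot> b\<close> makes the classes of \<open>a\<close> and \<open>b\<close> a parallel pair of maps of
  sample spaces with equal composites.
\<close>

lemma invariant_sampleD:
  assumes q: "q \<in> hom C \<I> X'" and e: "e \<in> hom C X' X"
    and inv: "invariant (sample_cat C) P (sample X' q X e) y"
    and r: "r \<in> hom C \<I> Z" and a: "as_deterministic C Z X' r a" and b: "as_deterministic C Z X' r b"
    and ab: "a \<cdot> r = q" "b \<cdot> r = q" "(e \<cdot> a, e \<cdot> b) \<in> as_rel C Z X r"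
  shows "Act P y (sample Z r X' a) = Act P y (sample Z r X' b)"
proof -
  have ab': "a \<in> hom C Z X'" "b \<in> hom C Z X'" using a b by (auto simp: as_deterministic_def)
  have "as_class C Z X r (e \<cdot> a) = as_class C Z X r (e \<cdot> b)"
    using ab' e ab(3) by (subst as_class_eq_iff) (auto intro: Comp_hom)
  moreover have "(e \<cdot> a) \<cdot> r = (e \<cdot> b) \<cdot> r"
    using ab Comp_assoc[OF r ab'(1) e] Comp_assoc[OF r ab'(2) e] by simp
  ultimately have eq: "sample X' q X e \<cdot>\<^bsub>sample_cat C\<^esub> sample Z r X' a
      = sample X' q X e \<cdot>\<^bsub>sample_cat C\<^esub> sample Z r X' b"
    using sample_comp[OF r ab'(1) e] sample_comp[OF r ab'(2) e] unfolding ab by simp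
  have Z: "(Z, r) \<in> Obj (sample_cat C)" using r by (simp add: sample_cat_Obj)
  have hom: "sample Z r X' a \<in> hom (sample_cat C) (Z, r) (Dom (sample_cat C) (sample X' q X e))"
    "sample Z r X' b \<in> hom (sample_cat C) (Z, r) (Dom (sample_cat C) (sample X' q X e))"
    using sample_hom[OF r a refl] sample_hom[OF r b refl] by (simp_all only: ab sample_cat_simps)
  show ?thesis
    by (rule inv[unfolded invariant_def, rule_format, OF Z hom eq])
qed

lemma atomic_sheaf_RE:
  "atomic_sheaf (sample_cat C) (RE C V)"
proof -
  interpret S: category "sample_cat C" by (rule category_sample_cat)
  have Act: "Act (RE C V) (as_class C Y V (f \<cdot> p) g) (sample X p Y f) = as_class C X V p (g \<cdot> f)"
    if "p \<in> hom C \<I> X" "f \<in> hom C X Y" "g \<in> hom C Y V" for X p Y f g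
    using class_comp_as_class[OF that] by (simp add: RE_def)
  have Sect: "x \<in> Sect (RE C V) (X, p) \<longleftrightarrow> (\<exists>f. x = as_class C X V p f \<and> as_deterministic C X V p f \<and> f \<in> hom C X V)"
    for x X p by (auto simp: RE_def as_deterministic_def)
  have "presheaf (sample_cat C) (RE C V)"
  proof
    fix F A B x assume "F \<in> hom (sample_cat C) A B" "x \<in> Sect (RE C V) B"
    then obtain X p Y f g where F: "A = (X, p)" "F = sample X p Y f"
        "p \<in> hom C \<I> X" "as_deterministic C X Y p f" "f \<in> hom C X Y"
      and x: "x = as_class C Y V (f \<cdot> p) g" "as_deterministic C Y V (f \<cdot> p) g" "g \<in> hom C Y V"
      by (auto elim!: sample_homE simp: Sect)
    show "Act (RE C V) x F \<in> Sect (RE C V) A"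
      unfolding F(1,2) x(1) Act[OF F(3,5) x(3)] Sect
      using as_deterministic_comp[OF F(3,4) x(2)] Comp_hom[OF F(5) x(3)] by blast
  next
    fix A x assume "A \<in> Obj (sample_cat C)" "x \<in> Sect (RE C V) A"
    then obtain X p g where A: "A = (X, p)" "p \<in> hom C \<I> X" and x: "x = as_class C X V p g" "g \<in> hom C X V"
      by (cases A) (auto simp: sample_cat_Obj Sect)
    have X: "X \<in> Obj C" using A by (simp add: hom_iff)
    have "Ident C X \<cdot> p = p" using A by (simp add: Comp_Ident_left)
    thus "Act (RE C V) x (Ident (sample_cat C) A) = x"
      unfolding A x using Act[OF A(2) Ident_hom[OF X] x(2)] x by (simp add: Comp_Ident_right)
  next
    fix F G A B D x
    assume "F \<in> hom (sample_cat C) A B" "G \<in> hom (sample_cat C) B D" "x \<in> Sect (RE C V) D"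
    then obtain X p Y f Z g h where F: "F = sample X p Y f" "p \<in> hom C \<I> X" "f \<in> hom C X Y"
      and G: "G = sample Y (f \<cdot> p) Z g" "g \<in> hom C Y Z"
      and x: "x = as_class C Z V (g \<cdot> f \<cdot> p) h" "h \<in> hom C Z V"
      by (auto elim!: sample_homE simp: Sect)
    have fp: "f \<cdot> p \<in> hom C \<I> Y" and gf: "g \<cdot> f \<in> hom C X Z" and hg: "h \<cdot> g \<in> hom C Y V"
      using F G x by (auto intro: Comp_hom)
    show "Act (RE C V) x (G \<cdot>\<^bsub>sample_cat C\<^esub> F) = Act (RE C V) (Act (RE C V) x G) F"
      unfolding F(1) G(1) x(1) Act[OF fp G(2) x(2)] Act[OF F(2,3) hg] sample_comp[OF F(2,3) G(2)]
      using Act[OF F(2) gf x(2)] Comp_assoc[OF F(2,3) G(2)] Comp_assoc[OF F(3) G(2) x(2)] by simp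
  qed
  moreover have "\<exists>!x. x \<in> Sect (RE C V) (Cod (sample_cat C) E) \<and> Y = Act (RE C V) x E"
    if "E \<in> Arr (sample_cat C)" and "Y \<in> Sect (RE C V) (Dom (sample_cat C) E)"
      and inv: "invariant (sample_cat C) (RE C V) E Y" for E Y
  proof -
    from that obtain X' q X e y where E: "E = sample X' q X e" and q: "q \<in> hom C \<I> X'"
      and e: "as_deterministic C X' X q e" and e': "e \<in> hom C X' X"
      and Y: "Y = as_class C X' V q y" and y: "as_deterministic C X' V q y" and y': "y \<in> hom C X' V"
      by (auto elim!: sample_ArrE simp: Sect)
    obtain x where x: "as_deterministic C X V (e \<cdot> q) x" and xy: "(x \<cdot> e, y) \<in> as_rel C X' V q"
    proof (rule descent[OF e q y])
      fix Z r a b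
      assume r: "r \<in> hom C \<I> Z" and ab: "as_deterministic C Z X' r a" "as_deterministic C Z X' r b"
        "a \<cdot> r = q" "b \<cdot> r = q" "(e \<cdot> a, e \<cdot> b) \<in> as_rel C Z X r"
      have ab': "a \<in> hom C Z X'" "b \<in> hom C Z X'" using ab by (auto simp: as_deterministic_def)
      have "as_class C Z V r (y \<cdot> a) = as_class C Z V r (y \<cdot> b)"
        using invariant_sampleD[OF q e' inv[unfolded E] r ab] Act[OF r ab'(1) y'] Act[OF r ab'(2) y']
        unfolding ab Y by simp
      thus "(y \<cdot> a, y \<cdot> b) \<in> as_rel C Z V r"
        using as_class_eq_iff[OF Comp_hom[OF ab'(1) y'] Comp_hom[OF ab'(2) y']] by simp
    qed
    have x': "x \<in> hom C X V" using x by (simp add: as_deterministic_def)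
    show ?thesis
    proof (rule ex1I[of _ "as_class C X V (e \<cdot> q) x"])
      have "as_class C X' V q y = as_class C X' V q (x \<cdot> e)"
        using as_class_eq_iff[OF y' Comp_hom[OF e' x']] as_rel_sym[OF xy] by simp
      thus "as_class C X V (e \<cdot> q) x \<in> Sect (RE C V) (Cod (sample_cat C) E) \<and> Y = Act (RE C V) (as_class C X V (e \<cdot> q) x) E"
        unfolding E Y Act[OF q e' x'] using x x' by (auto simp: Sect)
    next
      fix Z assume Z: "Z \<in> Sect (RE C V) (Cod (sample_cat C) E) \<and> Y = Act (RE C V) Z E"
      then obtain z where z: "Z = as_class C X V (e \<cdot> q) z" "z \<in> hom C X V" by (auto simp: E Sect)
      with Z have "as_class C X' V q y = as_class C X' V q (z \<cdot> e)"
        using Act[OF q e' z(2)] by (simp add: E Y)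
      hence "(y, z \<cdot> e) \<in> as_rel C X' V q"
        using as_class_eq_iff[OF y' Comp_hom[OF e' z(2)]] by simp
      from as_rel_cancel[OF e q z(2) x' as_rel_sym[OF as_rel_trans[OF xy this]]]
      show "Z = as_class C X V (e \<cdot> q) x"
        unfolding z(1) using as_class_eq_iff[OF z(2) x'] by simp
    qed
  qed
  ultimately show ?thesis by (simp add: atomic_sheaf_def)
qed

lemma atomic_sheaf_representable:
  "atomic_sheaf (sample_cat C) (representable (sample_cat C) V)"
proof -
  interpret S: category "sample_cat C" by (rule category_sample_cat)
  let ?P = "representable (sample_cat C) V"
  obtain W v where W: "V = (W, v)" by (cases V)
  have "presheaf (sample_cat C) ?P"
  proof
    fix F A B x assume "F \<in> hom (sample_cat C) A B" "x \<in> Sect ?P B"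
    thus "Act ?P x F \<in> Sect ?P A" unfolding representable_simps by (rule S.Comp_hom)
  next
    fix A x assume "x \<in> Sect ?P A"
    thus "Act ?P x (Ident (sample_cat C) A) = x" unfolding representable_simps by (rule S.Comp_Ident_right)
  next
    fix F G A B D x
    assume "F \<in> hom (sample_cat C) A B" "G \<in> hom (sample_cat C) B D" "x \<in> Sect ?P D"
    thus "Act ?P x (G \<cdot>\<^bsub>sample_cat C\<^esub> F) = Act ?P (Act ?P x G) F"
      unfolding representable_simps by (rule S.Comp_assoc[symmetric])
  qed
  moreover have "\<exists>!x. x \<in> Sect ?P (Cod (sample_cat C) E) \<and> Y = Act ?P x E"
    if "E \<in> Arr (sample_cat C)" and "Y \<in> Sect ?P (Dom (sample_cat C) E)"
      and inv: "invariant (sample_cat C) ?P E Y" for E Y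
  proof -
    from that(1) obtain X' q X e where E: "E = sample X' q X e" and q: "q \<in> hom C \<I> X'"
      and e: "as_deterministic C X' X q e" and e': "e \<in> hom C X' X"
      by (elim sample_ArrE)
    have "Y \<in> hom (sample_cat C) (X', q) (W, v)" using that(2) by (simp only: representable_simps E W sample_cat_simps)
    then obtain y where Y: "Y = sample X' q W y" and v: "v = y \<cdot> q"
      and y: "as_deterministic C X' W q y" and y': "y \<in> hom C X' W"
      by (elim sample_homE) simp
    obtain x where x: "as_deterministic C X W (e \<cdot> q) x" and xy: "(x \<cdot> e, y) \<in> as_rel C X' W q"
    proof (rule descent[OF e q y])
      fix Z r a b
      assume r: "r \<in> hom C \<I> Z" and ab: "as_deterministic C Z X' r a" "as_deterministic C Z X' r b"
        "a \<cdot> r = q" "b \<cdot> r = q" "(e \<cdot> a, e \<cdot> b) \<in> as_rel C Z X r"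
      have ab': "a \<in> hom C Z X'" "b \<in> hom C Z X'" using ab by (auto simp: as_deterministic_def)
      have "as_class C Z W r (y \<cdot> a) = as_class C Z W r (y \<cdot> b)"
        using invariant_sampleD[OF q e' inv[unfolded E] r ab]
          sample_comp[OF r ab'(1) y'] sample_comp[OF r ab'(2) y']
        unfolding ab Y by simp
      thus "(y \<cdot> a, y \<cdot> b) \<in> as_rel C Z W r"
        using as_class_eq_iff[OF Comp_hom[OF ab'(1) y'] Comp_hom[OF ab'(2) y']] by simp
    qed
    have x': "x \<in> hom C X W" using x by (simp add: as_deterministic_def)
    have p: "e \<cdot> q \<in> hom C \<I> X" by (rule Comp_hom[OF q e'])
    have xv: "v = x \<cdot> e \<cdot> q"
      using as_rel_state[OF xy q] Comp_assoc[OF q e' x'] v by simp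
    show ?thesis
    proof (rule ex1I[of _ "sample X (e \<cdot> q) W x"])
      have "as_class C X' W q y = as_class C X' W q (x \<cdot> e)"
        using as_class_eq_iff[OF y' Comp_hom[OF e' x']] as_rel_sym[OF xy] by simp
      moreover have "sample X (e \<cdot> q) W x \<in> hom (sample_cat C) (X, e \<cdot> q) V"
        unfolding W xv by (rule sample_hom[OF p x refl])
      ultimately show "sample X (e \<cdot> q) W x \<in> Sect ?P (Cod (sample_cat C) E) \<and> Y = Act ?P (sample X (e \<cdot> q) W x) E"
        unfolding E Y representable_simps sample_comp[OF q e' x'] using v xv Comp_assoc[OF q e' x'] by simp
    next
      fix Z assume Z: "Z \<in> Sect ?P (Cod (sample_cat C) E) \<and> Y = Act ?P Z E"
      hence "Z \<in> hom (sample_cat C) (X, e \<cdot> q) (W, v)"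
        by (simp only: representable_simps E W sample_cat_simps)
      then obtain z where z: "Z = ((X, e \<cdot> q), (W, v), as_class C X W (e \<cdot> q) z)" "v = z \<cdot> e \<cdot> q" "z \<in> hom C X W"
        by (auto elim!: sample_homE)
      with Z have "as_class C X' W q y = as_class C X' W q (z \<cdot> e)"
        using sample_comp[OF q e' z(3)] by (simp add: E Y)
      hence "(y, z \<cdot> e) \<in> as_rel C X' W q"
        using as_class_eq_iff[OF y' Comp_hom[OF e' z(3)]] by simp
      from as_rel_cancel[OF e q z(3) x' as_rel_sym[OF as_rel_trans[OF xy this]]]
      show "Z = sample X (e \<cdot> q) W x"
        unfolding z(1) using as_class_eq_iff[OF z(3) x'] xv by simp
    qed
  qed
  ultimately show ?thesis by (simp add: atomic_sheaf_def)
qed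

end


theorem proposition24:
  fixes C :: "('o, 'a) markov_data"
  assumes "markov_category C" and "has_conditionals C"
  shows "(\<forall>V\<in>Obj C. atomic_sheaf (sample_cat C) (RE C V)) \<and>
         (\<forall>V\<in>Obj (sample_cat C). atomic_sheaf (sample_cat C) (representable (sample_cat C) V))"
proof -
  interpret markov_category_with_conditionals C
    using assms by (simp add: markov_category_with_conditionals_def markov_category_with_conditionals_axioms_def)
  show ?thesis using atomic_sheaf_RE atomic_sheaf_representable by blast
qed

end
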